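(* Let $p(\cdot)\in\mathscr{P}_0\cap\mathrm{LH}$ be a variable exponent on $\mathbb{R}^n$, let $\widetilde{q}\in(0,p_-)$, let $x_0\in\mathbb{R}^n$, and let $w$ be a weight on $\mathbb{R}^n$ with $w^{\widetilde{q}}\in\mathcal{A}_{p(\cdot)/\widetilde{q}}$. Then a family $\mathcal{F}\subset L^{p(\cdot)}(w)$ is totally bounded (equivalently, relatively compact) in $L^{p(\cdot)}(w)$ if and only if all of the following hold: (i) $\sup_{f\in\mathcal{F}}\|f\|_{L^{p(\cdot)}(w)}<\infty$; (ii) $\displaystyle\lim_{r\to0}\sup_{f\in\mathcal{F}}\Big\|\Big(\frac{1}{|B(\cdot,r)|}\int_{B(\cdot,r)}|f(\cdot)-f(y)|^{\widetilde{q}}\,dy\Big)^{1/\widetilde{q}}\Big\|_{L^{p(\cdot)}(w)}=0$; (iii) $\displaystyle\lim_{R\to\infty}\sup_{f\in\mathcal{F}}\|f\chi_{\mathbb{R}^n\setminus B(x_0,R)}\|_{L^{p(\cdot)}(w)}=0$.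
   Context: A variable exponent on a measurable set $\Omega$ is a measurable $p(\cdot):\Omega\to[0,\infty]$; $p_-=\operatorname{ess\,inf}p$, $p_+=\operatorname{ess\,sup}p$. $\mathscr{P}_0=\{p(\cdot):0<p_-\le p_+<\infty\}$, $\mathscr{P}=\{p(\cdot):1<p_-\le p_+<\infty\}$; for $p\in\mathscr{P}$, $p'$ is defined by $1/p+1/p'=1$. For $p\in\mathscr{P}_0$, $\|f\|_{p(\cdot)}=\inf\{\lambda>0:\int_\Omega|f(x)/\lambda|^{p(x)}dx\le1\}$ (Luxemburg (quasi)norm), and $L^{p(\cdot)}$ is the space of measurable $f$ with $\|f\|_{p(\cdot)}<\infty$. A weight is a measurable $w$ with $0<w<\infty$ a.e.; $L^{p(\cdot)}(w)$ consists of $f$ with $\|f\|_{L^{p(\cdot)}(w)}:=\|fw\|_{p(\cdot)}<\infty$. $p(\cdot):\mathbb{R}^n\to\mathbb{R}$ is in $\mathrm{LH}$ if there are $C_0,C_\infty>0$ and $p_\infty\in\mathbb{R}$ with $|p(x)-p(y)|\le C_0/(-\log|x-y|)$ whenever $|x-y|<1/2$, and $|p(x)-p_\infty|\le C_\infty/\log(e+|x|)$ for all $x$. For $p\in\mathscr{P}$, $w\in\mathcal{A}_{p(\cdot)}$ means $\sup_Q|Q|^{-1}\|w\chi_Q\|_{p(\cdot)}\|w^{-1}\chi_Q\|_{p'(\cdot)}<\infty$, the supremum over all cubes $Q\subset\mathbb{R}^n$. $B(x,r)$ is the open Euclidean ball. *)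

theory Defs
  imports "HOL-Analysis.Analysis"
begin

definition ess_inf_exp :: "('a::euclidean_space \<Rightarrow> real) \<Rightarrow> real" where
  "ess_inf_exp p = Sup {a. AE x in lebesgue. a \<le> p x}"

definition ess_sup_exp :: "('a::euclidean_space \<Rightarrow> real) \<Rightarrow> real" where
  "ess_sup_exp p = Inf {b. AE x in lebesgue. p x \<le> b}"

definition in_P0 :: "('a::euclidean_space \<Rightarrow> real) \<Rightarrow> bool" where
  "in_P0 p \<longleftrightarrow> p \<in> borel_measurable lebesgue \<and>
     (\<exists>a>0. AE x in lebesgue. a \<le> p x) \<and> (\<exists>b. AE x in lebesgue. p x \<le> b)"

definition in_P :: "('a::euclidean_space \<Rightarrow> real) \<Rightarrow> bool" where
  "in_P p \<longleftrightarrow> p \<in> borel_measurable lebesgue \<and>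
     (\<exists>a>1. AE x in lebesgue. a \<le> p x) \<and> (\<exists>b. AE x in lebesgue. p x \<le> b)"

definition conj_exp :: "('a \<Rightarrow> real) \<Rightarrow> 'a \<Rightarrow> real" where
  "conj_exp p x = p x / (p x - 1)"

definition in_LH :: "('a::euclidean_space \<Rightarrow> real) \<Rightarrow> bool" where
  "in_LH p \<longleftrightarrow> (\<exists>C0>0. \<exists>Cinf>0. \<exists>pinf::real.
     (\<forall>x y. norm (x - y) < 1/2 \<longrightarrow> \<bar>p x - p y\<bar> \<le> C0 / (- ln (norm (x - y)))) \<and>
     (\<forall>x. \<bar>p x - pinf\<bar> \<le> Cinf / ln (exp 1 + norm x)))"

definition enn_pow :: "ennreal \<Rightarrow> real \<Rightarrow> ennreal" where
  "enn_pow t e = (if t = \<infinity> then \<infinity> else ennreal (enn2real t powr e))"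

text \<open>Luxemburg (quasi)norm of a [0,infinity]-valued function; value infinity
  means the function is not in the space (Inf of the empty set).\<close>
definition lux_norm_enn :: "('a::euclidean_space \<Rightarrow> real) \<Rightarrow> ('a \<Rightarrow> ennreal) \<Rightarrow> ennreal" where
  "lux_norm_enn p g = Inf {ennreal l | l. l > 0 \<and>
      (\<integral>\<^sup>+ x. enn_pow (g x / ennreal l) (p x) \<partial>lebesgue) \<le> 1}"

definition lux_norm :: "('a::euclidean_space \<Rightarrow> real) \<Rightarrow> ('a \<Rightarrow> real) \<Rightarrow> ennreal" where
  "lux_norm p f = lux_norm_enn p (\<lambda>x. ennreal \<bar>f x\<bar>)"

definition wnorm :: "('a::euclidean_space \<Rightarrow> real) \<Rightarrow> ('a \<Rightarrow> real) \<Rightarrow> ('a \<Rightarrow> real) \<Rightarrow> ennreal" where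
  "wnorm p w f = lux_norm p (\<lambda>x. f x * w x)"

definition wnorm_enn :: "('a::euclidean_space \<Rightarrow> real) \<Rightarrow> ('a \<Rightarrow> real) \<Rightarrow> ('a \<Rightarrow> ennreal) \<Rightarrow> ennreal" where
  "wnorm_enn p w g = lux_norm_enn p (\<lambda>x. g x * ennreal \<bar>w x\<bar>)"

definition Lpw :: "('a::euclidean_space \<Rightarrow> real) \<Rightarrow> ('a \<Rightarrow> real) \<Rightarrow> ('a \<Rightarrow> real) set" where
  "Lpw p w = {f. f \<in> borel_measurable lebesgue \<and> wnorm p w f < \<infinity>}"

definition is_weight :: "('a::euclidean_space \<Rightarrow> real) \<Rightarrow> bool" where
  "is_weight w \<longleftrightarrow> w \<in> borel_measurable lebesgue \<and> (AE x in lebesgue. 0 < w x)"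

definition cube :: "'a::euclidean_space \<Rightarrow> real \<Rightarrow> 'a set" where
  "cube c r = {x. \<forall>i\<in>Basis. \<bar>x \<bullet> i - c \<bullet> i\<bar> \<le> r}"

definition A_var :: "('a::euclidean_space \<Rightarrow> real) \<Rightarrow> ('a \<Rightarrow> real) \<Rightarrow> bool" where
  "A_var p w \<longleftrightarrow> in_P p \<and> (\<exists>C::real. \<forall>c r. r > 0 \<longrightarrow>
     lux_norm p (\<lambda>x. w x * indicator (cube c r) x)
       * lux_norm (conj_exp p) (\<lambda>x. indicator (cube c r) x / w x)
     \<le> ennreal C * emeasure lebesgue (cube c r))"

definition totally_bounded_Lpw :: "('a::euclidean_space \<Rightarrow> real) \<Rightarrow> ('a \<Rightarrow> real) \<Rightarrow> ('a \<Rightarrow> real) set \<Rightarrow> bool" where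
  "totally_bounded_Lpw p w F \<longleftrightarrow> (\<forall>e>0. \<exists>G. finite G \<and> G \<subseteq> Lpw p w \<and>
      (\<forall>f\<in>F. \<exists>g\<in>G. wnorm p w (\<lambda>x. f x - g x) < ennreal e))"

definition osc :: "real \<Rightarrow> real \<Rightarrow> ('a::euclidean_space \<Rightarrow> real) \<Rightarrow> 'a \<Rightarrow> ennreal" where
  "osc q r f x = enn_pow ((\<integral>\<^sup>+ y \<in> ball x r. ennreal (\<bar>f x - f y\<bar> powr q) \<partial>lebesgue)
                          / emeasure lebesgue (ball x r)) (1 / q)"

end

(* On a cube Q the Muckenhoupt condition and Young's inequality bound the modular of the mean value
   of f over Q by a power of the modular of f on Q, with an exponent slightly below 1. Log-Hoelder continuity
   makes this loss harmless on cubes of one small size, so averages over balls of a small radius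
   are bounded on the weighted space, and hence so is the mean oscillation operator. With the density
   of continuous functions of compact support this gives the necessity of the oscillation condition.
   Conversely, on a small ball f is within a multiple of its oscillation of the value at a point where
   the oscillation is almost minimal; this approximates f on a large ball by step functions
   on a fixed finite partition with bounded coefficients. *)

theory Submission
  imports Defs
begin

subsection \<open>Luxemburg norms with bounded exponents\<close>

text \<open>As p may lie below 1, f need not be locally integrable. The estimates therefore concern
  |f|^q, with exponent p/q bounded below by a number above 1 and weight w^q, and norms are
  quasinorms with a constant \<open>K\<close> in the triangle inequality. The loss of exponent
  arises as follows: on a cube the norm can be read off the modular \<alpha> only up to the spread
  of the exponent, and normalising with its upper bound S but estimating the mean with its lower
  bound s leaves \<alpha>^(s/S). For tiny \<alpha> no multiple of \<alpha> bounds this, so a floor T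
  = h^n / (e + |c|)^(n+1) is added, c being the centre of the cube. Its factor h^n is matched to the
  local log-Hoelder condition, the other one to the condition at infinity, and the power n+1 makes
  the sum of T over the cubes finite, uniformly in h. No maximal operator occurs, since only one
  radius at a time is averaged. In the converse, the coefficients of the step functions are bounded
  by comparing the norm of a cell's indicator with that of f, then rounded; a cell of norm zero
  gives no bound and gets coefficient 0.\<close>

lemma enn_pow_ennreal: "0 \<le> x \<Longrightarrow> enn_pow (ennreal x) e = ennreal (x powr e)"
  by (simp add: enn_pow_def)

lemma enn_pow_0 [simp]: "enn_pow 0 e = 0"
  by (simp add: enn_pow_def)

lemma enn_pow_top [simp]: "enn_pow top e = top"
  by (simp add: enn_pow_def)

lemma enn_pow_mono: "0 < e \<Longrightarrow> s \<le> t \<Longrightarrow> enn_pow s e \<le> enn_pow t e"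
  by (cases s; cases t) (auto simp: enn_pow_ennreal top_unique intro!: ennreal_leI powr_mono2)

text \<open>True for every real exponent, also a nonpositive one: \<open>0 powr e\<close> is 0 and
  infinity is sent to infinity by definition, so the case 0 times infinity gives 0 on both
  sides.\<close>

lemma enn_pow_mult: "enn_pow (s * t) e = enn_pow s e * enn_pow t e"
proof (cases s; cases t)
  fix x y assume "0 \<le> x" "s = ennreal x" "0 \<le> y" "t = ennreal y"
  then show ?thesis
    by (simp add: enn_pow_ennreal powr_mult flip: ennreal_mult)
next
  fix x assume "0 \<le> x" "s = ennreal x" "t = top"
  then show ?thesis by (cases "x = 0") (auto simp: enn_pow_ennreal ennreal_mult_top)
next
  fix x assume "0 \<le> x" "t = ennreal x" "s = top"
  then show ?thesis by (cases "x = 0") (auto simp: enn_pow_ennreal ennreal_top_mult)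
qed simp

lemma enn_pow_enn_pow: "enn_pow (enn_pow t d) e = enn_pow t (d * e)"
  by (cases t) (auto simp: enn_pow_ennreal powr_powr)

lemma enn_pow_one [simp]: "enn_pow t 1 = t"
  by (cases t) (auto simp: enn_pow_ennreal)

text \<open>Comparing the sum with twice the maximum treats exponents below and above 1 alike, so no
  convexity enters.\<close>

lemma enn_pow_add_le:
  assumes "0 < e"
  shows "enn_pow (s + t) e \<le> ennreal (2 powr e) * (enn_pow s e + enn_pow t e)"
proof -
  have "s + t \<le> ennreal 2 * max s t"
    using add_mono[of s "max s t" t "max s t"] by (simp add: mult_2)
  then have "enn_pow (s + t) e \<le> enn_pow (ennreal 2 * max s t) e"
    by (rule enn_pow_mono[OF assms])
  also have "\<dots> = ennreal (2 powr e) * enn_pow (max s t) e"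
    by (simp add: enn_pow_mult enn_pow_ennreal[of 2, simplified])
  also have "\<dots> \<le> ennreal (2 powr e) * (enn_pow s e + enn_pow t e)"
    by (intro mult_left_mono) (auto simp: max_def)
  finally show ?thesis .
qed

lemma enn_pow_measurable [measurable]:
  assumes [measurable]: "g \<in> borel_measurable M" "p \<in> borel_measurable M"
  shows "(\<lambda>x. enn_pow (g x) (p x)) \<in> borel_measurable M"
  unfolding enn_pow_def by measurable

lemma divide_ennreal_real: "0 < l \<Longrightarrow> t / ennreal l = ennreal (1 / l) * t"
  by (simp add: divide_ennreal_def inverse_ennreal inverse_eq_divide mult.commute)

lemma enn_pow_cmult: "0 < c \<Longrightarrow> enn_pow (ennreal c * t) e = ennreal (c powr e) * enn_pow t e"
  by (simp add: enn_pow_mult enn_pow_ennreal)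

text \<open>The norm is an infimum and need not be an admissible scale itself. Norm inequalities are
  therefore proved through this rule, for every real \<open>l\<close> strictly above the norm, where
  \<open>modular_le_one\<close> applies.\<close>

lemma ennreal_le_cmult_of_less:
  fixes t X :: ennreal
  assumes C: "0 < C" and le: "\<And>l. 0 < l \<Longrightarrow> t < ennreal l \<Longrightarrow> X \<le> ennreal (C * l)"
  shows "X \<le> ennreal C * t"
proof (cases t)
  case (real x)
  show ?thesis
  proof (rule ennreal_le_epsilon)
    fix e :: real assume "0 < e"
    have "X \<le> ennreal (C * (x + e / C))"
      using real \<open>0 < e\<close> C by (intro le) (auto simp: ennreal_less_iff add_nonneg_pos)
    also have "\<dots> = ennreal C * t + ennreal e"
      using real C \<open>0 < e\<close> by (simp add: field_simps flip: ennreal_mult ennreal_plus)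
    finally show "X \<le> ennreal C * t + ennreal e" .
  qed
next
  case top
  then show ?thesis using C by (simp add: ennreal_mult_top)
qed

section \<open>The modular and the Luxemburg quasinorm\<close>

locale bdd_exponent =
  fixes p :: "'a::euclidean_space \<Rightarrow> real" and a b :: real
  assumes exponent_measurable [measurable]: "p \<in> borel_measurable lebesgue"
    and a_pos: "0 < a" and a_le_b: "a \<le> b"
    and AE_exponent: "AE x in lebesgue. a \<le> p x \<and> p x \<le> b"
begin

lemma AE_exponent_pos: "AE x in lebesgue. 0 < p x"
  using AE_exponent a_pos by (auto elim: eventually_mono)

definition modular :: "('a \<Rightarrow> ennreal) \<Rightarrow> ennreal" where
  "modular g = (\<integral>\<^sup>+ x. enn_pow (g x) (p x) \<partial>lebesgue)"

lemma modular_mono_AE: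
  assumes "AE x in lebesgue. g x \<le> h x"
  shows "modular g \<le> modular h"
  unfolding modular_def
  by (rule nn_integral_mono_AE) (use assms AE_exponent_pos in eventually_elim, simp add: enn_pow_mono)

text \<open>Which end of [a, b] maximises \<open>c powr e\<close> depends on whether c is below or
  above 1, so the bound \<open>d\<close> is left to each use.\<close>

lemma modular_cmult_le:
  assumes [measurable]: "g \<in> borel_measurable lebesgue" and c: "0 < c"
    and d: "\<And>e. a \<le> e \<Longrightarrow> e \<le> b \<Longrightarrow> c powr e \<le> d"
  shows "modular (\<lambda>x. ennreal c * g x) \<le> ennreal d * modular g"
proof -
  have "modular (\<lambda>x. ennreal c * g x) \<le> (\<integral>\<^sup>+ x. ennreal d * enn_pow (g x) (p x) \<partial>lebesgue)"
    unfolding modular_def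
    by (rule nn_integral_mono_AE, use AE_exponent in eventually_elim)
       (use c d in \<open>auto simp: enn_pow_cmult intro!: mult_right_mono ennreal_leI\<close>)
  also have "\<dots> = ennreal d * modular g"
    unfolding modular_def by (rule nn_integral_cmult) measurable
  finally show ?thesis .
qed

lemma lux_norm_enn_le:
  assumes "0 < l" "modular (\<lambda>x. g x / ennreal l) \<le> 1"
  shows "lux_norm_enn p g \<le> ennreal l"
  unfolding lux_norm_enn_def using assms by (intro Inf_lower) (auto simp: modular_def)

lemma modular_le_one:
  assumes "lux_norm_enn p g < ennreal l"
  shows "modular (\<lambda>x. g x / ennreal l) \<le> 1"
proof -
  obtain m where m: "0 < m" "modular (\<lambda>x. g x / ennreal m) \<le> 1" "ennreal m < ennreal l"
    using assms unfolding lux_norm_enn_def Inf_less_iff by (auto simp: modular_def)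
  have "m < l" using m by (simp add: ennreal_less_iff)
  then have "modular (\<lambda>x. g x / ennreal l) \<le> modular (\<lambda>x. g x / ennreal m)"
    using m by (intro modular_mono_AE AE_I2)
      (auto simp: divide_ennreal_real frac_le intro!: mult_right_mono ennreal_leI)
  with m show ?thesis by simp
qed

lemma lux_norm_mono_AE:
  assumes "AE x in lebesgue. g x \<le> h x"
  shows "lux_norm_enn p g \<le> lux_norm_enn p h"
proof -
  have "lux_norm_enn p g \<le> ennreal 1 * lux_norm_enn p h"
  proof (rule ennreal_le_cmult_of_less)
    fix l assume l: "0 < l" "lux_norm_enn p h < ennreal l"
    have "modular (\<lambda>x. g x / ennreal l) \<le> modular (\<lambda>x. h x / ennreal l)"
      by (rule modular_mono_AE, use assms in eventually_elim)
         (use l in \<open>simp add: divide_ennreal_real mult_left_mono\<close>)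
    with modular_le_one[OF l(2)] show "lux_norm_enn p g \<le> ennreal (1 * l)"
      using l by (auto intro!: lux_norm_enn_le)
  qed simp
  then show ?thesis by simp
qed

lemma lux_norm_cmult_le:
  assumes c: "0 < c"
  shows "lux_norm_enn p (\<lambda>x. ennreal c * g x) \<le> ennreal c * lux_norm_enn p g"
proof (rule ennreal_le_cmult_of_less[OF c])
  fix l assume l: "0 < l" "lux_norm_enn p g < ennreal l"
  have "(\<lambda>x. ennreal c * g x / ennreal (c * l)) = (\<lambda>x. g x / ennreal l)"
    using c l by (simp add: divide_ennreal_real flip: mult.assoc ennreal_mult)
  with modular_le_one[OF l(2)] show "lux_norm_enn p (\<lambda>x. ennreal c * g x) \<le> ennreal (c * l)"
    using c l by (auto intro!: lux_norm_enn_le)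
qed

text \<open>The triangle constant: since p >= a, the number (1/K)^p is at most 1/2, which brings the
  sum of two modulars, each at most 1, back to at most 1.\<close>

definition K :: real where "K = 2 powr (1 / a)"

lemma K_pos: "0 < K" by (simp add: K_def)

lemma lux_norm_add_le:
  assumes [measurable]: "g \<in> borel_measurable lebesgue" "h \<in> borel_measurable lebesgue"
  shows "lux_norm_enn p (\<lambda>x. g x + h x) \<le> ennreal K * (lux_norm_enn p g + lux_norm_enn p h)"
proof (rule ennreal_le_cmult_of_less[OF K_pos])
  fix L assume L: "0 < L" "lux_norm_enn p g + lux_norm_enn p h < ennreal L"
  obtain x where x: "0 \<le> x" "lux_norm_enn p g = ennreal x"
    using L by (cases "lux_norm_enn p g") auto
  obtain y where y: "0 \<le> y" "lux_norm_enn p h = ennreal y"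
    using L by (cases "lux_norm_enn p h") auto
  have xy: "x + y < L"
    using L x y by (simp add: ennreal_less_iff flip: ennreal_plus)
  \<comment> \<open>The slack L - x - y is shared equally, so that both scales lie strictly above
    the norms and still add up to L.\<close>
  define l where "l = x + (L - x - y) / 2"
  define m where "m = y + (L - x - y) / 2"
  have lm: "0 < l" "0 < m" "x < l" "y < m" "l + m = L"
    using xy x y by (auto simp: l_def m_def field_simps)
  have g: "modular (\<lambda>z. g z / ennreal l) \<le> 1" and h: "modular (\<lambda>z. h z / ennreal m) \<le> 1"
    using lm x y by (auto intro!: modular_le_one simp: ennreal_less_iff)
  have pw: "enn_pow ((g z + h z) / ennreal (K * L)) (p z)
      \<le> ennreal (1/2) * (enn_pow (g z / ennreal l) (p z) + enn_pow (h z / ennreal m) (p z))"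
    if "a \<le> p z" for z
  proof -
    let ?u = "g z / ennreal l" and ?v = "h z / ennreal m"
    have "g z + h z = ennreal l * ?u + ennreal m * ?v"
      using lm by (simp add: divide_ennreal_real flip: mult.assoc ennreal_mult)
    also have "\<dots> \<le> ennreal l * max ?u ?v + ennreal m * max ?u ?v"
      by (intro add_mono mult_left_mono) auto
    also have "\<dots> = ennreal L * max ?u ?v"
      using lm(1,2,5) by (metis distrib_right ennreal_plus less_imp_le)
    finally have "(g z + h z) / ennreal (K * L) \<le> ennreal L * max ?u ?v / ennreal (K * L)"
      by (rule divide_right_mono_ennreal)
    also have "\<dots> = ennreal (1 / K) * max ?u ?v"
      using L K_pos by (simp add: divide_ennreal_real flip: mult.assoc ennreal_mult)
    finally have "enn_pow ((g z + h z) / ennreal (K * L)) (p z) \<le> enn_pow (ennreal (1 / K) * max ?u ?v) (p z)"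
      using that a_pos by (intro enn_pow_mono) auto
    also have "\<dots> = ennreal ((1 / K) powr p z) * enn_pow (max ?u ?v) (p z)"
      using K_pos by (simp add: enn_pow_cmult)
    also have "\<dots> \<le> ennreal (1/2) * (enn_pow ?u (p z) + enn_pow ?v (p z))"
    proof (intro mult_mono ennreal_leI)
      have "(1 / K) powr p z = 2 powr (- (p z / a))"
        by (simp add: K_def powr_divide powr_powr powr_minus_divide)
      also have "\<dots> \<le> 2 powr (- 1)"
        using that a_pos by (intro powr_mono) auto
      finally show "(1 / K) powr p z \<le> 1 / 2" by (simp add: powr_minus_divide)
    qed (auto simp: max_def)
    finally show ?thesis .
  qed
  have "modular (\<lambda>z. (g z + h z) / ennreal (K * L))
      \<le> (\<integral>\<^sup>+ z. ennreal (1/2) * (enn_pow (g z / ennreal l) (p z) + enn_pow (h z / ennreal m) (p z)) \<partial>lebesgue)"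
    unfolding modular_def
    by (rule nn_integral_mono_AE, use AE_exponent in eventually_elim) (use pw in auto)
  also have "\<dots> = ennreal (1/2) * (modular (\<lambda>z. g z / ennreal l) + modular (\<lambda>z. h z / ennreal m))"
    by (simp add: nn_integral_cmult nn_integral_add modular_def)
  also have "\<dots> \<le> ennreal (1/2) * (1 + 1)"
    by (intro mult_left_mono add_mono g h) auto
  also have "\<dots> = 1"
  proof -
    have "ennreal (1/2) * (1 + 1) = ennreal (1/2) * ennreal 2" by simp
    also have "\<dots> = ennreal (1/2 * 2)" by (rule ennreal_mult''[symmetric]) simp
    finally show ?thesis by simp
  qed
  finally show "lux_norm_enn p (\<lambda>x. g x + h x) \<le> ennreal (K * L)"
    using L K_pos by (intro lux_norm_enn_le) auto
qed

text \<open>With norm zero every positive scale is admissible; the scale l = 1/(n+1) bounds the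
  modular of g by l^a, which tends to 0.\<close>

lemma lux_norm_eq_0_AE:
  assumes [measurable]: "g \<in> borel_measurable lebesgue" and 0: "lux_norm_enn p g = 0"
  shows "AE x in lebesgue. g x = 0"
proof -
  have "modular g \<le> ennreal (inverse (real (Suc n)) powr a)" for n
  proof -
    let ?l = "inverse (real (Suc n))"
    have l: "0 < ?l" "?l \<le> 1" by (auto simp: inverse_le_1_iff)
    have "modular g = modular (\<lambda>x. ennreal ?l * (g x / ennreal ?l))"
      using l by (simp add: divide_ennreal_real del: of_nat_Suc flip: mult.assoc ennreal_mult)
    also have "\<dots> \<le> ennreal (?l powr a) * modular (\<lambda>x. g x / ennreal ?l)"
      using l by (intro modular_cmult_le powr_mono') auto
    also have "\<dots> \<le> ennreal (?l powr a) * 1"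
      using l 0 by (intro mult_left_mono modular_le_one) auto
    finally show ?thesis by simp
  qed
  moreover have "(\<lambda>n. ennreal (inverse (real (Suc n)) powr a)) \<longlonglongrightarrow> ennreal (0 powr a)"
    using a_pos by (intro tendsto_ennrealI tendsto_powr' LIMSEQ_inverse_real_of_nat tendsto_const)
      (auto intro!: always_eventually)
  ultimately have "modular g \<le> 0"
    by (intro LIMSEQ_le_const) auto
  then have "AE x in lebesgue. enn_pow (g x) (p x) = 0"
    unfolding modular_def by (subst (asm) le_zero_eq, subst (asm) nn_integral_0_iff_AE) auto
  then show ?thesis
    by eventually_elim (auto simp: enn_pow_def enn2real_eq_0_iff split: if_splits)
qed

text \<open>At the scale l = C^(1/a) the factor l^(-p) is C^(-p/a), at most 1/C because p >= a and C
  >= 1.\<close>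

lemma lux_norm_le_of_modular_le:
  assumes [measurable]: "g \<in> borel_measurable lebesgue" and C: "1 \<le> C" and "modular g \<le> ennreal C"
  shows "lux_norm_enn p g \<le> ennreal (C powr (1 / a))"
proof (rule lux_norm_enn_le)
  let ?l = "C powr (1 / a)"
  have "modular (\<lambda>x. g x / ennreal ?l) = modular (\<lambda>x. ennreal (1 / ?l) * g x)"
    using C by (simp add: divide_ennreal_real)
  also have "\<dots> \<le> ennreal (1 / C) * modular g"
  proof (rule modular_cmult_le)
    fix e assume "a \<le> e"
    have "(1 / ?l) powr e = C powr (- (e / a))"
      using C by (simp add: powr_divide powr_powr powr_minus_divide)
    also have "\<dots> \<le> C powr (- 1)"
      using \<open>a \<le> e\<close> a_pos C by (intro powr_mono) auto
    finally show "(1 / ?l) powr e \<le> 1 / C" using C by (simp add: powr_minus_divide)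
  qed (use C in auto)
  also have "\<dots> \<le> ennreal (1 / C) * ennreal C"
    using assms by (intro mult_left_mono) auto
  also have "\<dots> = 1"
    using C by (simp flip: ennreal_mult)
  finally show "modular (\<lambda>x. g x / ennreal ?l) \<le> 1" .
qed (use C in simp)

lemma modular_finite:
  assumes [measurable]: "g \<in> borel_measurable lebesgue" and fin: "lux_norm_enn p g < \<infinity>"
  shows "modular g < \<infinity>"
proof -
  obtain x where x: "0 \<le> x" "lux_norm_enn p g = ennreal x"
    using fin by (cases "lux_norm_enn p g") auto
  \<comment> \<open>The summand 1 puts l strictly above the norm and makes l >= 1, so that l^p is at
    most l^b.\<close>
  define l where "l = x + 1"
  have l: "1 \<le> l" "lux_norm_enn p g < ennreal l" using x by (auto simp: l_def ennreal_less_iff simp del: ennreal_plus)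
  have "modular g = modular (\<lambda>x. ennreal l * (g x / ennreal l))"
    using l by (simp add: divide_ennreal_real flip: mult.assoc ennreal_mult)
  also have "\<dots> \<le> ennreal (l powr b) * modular (\<lambda>x. g x / ennreal l)"
    using l by (intro modular_cmult_le powr_mono) auto
  also have "\<dots> \<le> ennreal (l powr b) * 1"
    using l by (intro mult_left_mono modular_le_one) auto
  also have "\<dots> < \<infinity>" by simp
  finally show ?thesis .
qed

text \<open>Smallness of the norm is dominated convergence of the modulars at the one scale e. The
  upper bound b on the exponent enters through \<open>modular_finite\<close>: it makes the modular
  of G/e finite.\<close>

lemma lux_norm_dominated_convergence:
  assumes [measurable]: "\<And>n. g n \<in> borel_measurable lebesgue" "G \<in> borel_measurable lebesgue"
    and fin: "lux_norm_enn p G < \<infinity>" 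
    and dom: "\<And>n. AE x in lebesgue. g n x \<le> G x"
    and lim: "AE x in lebesgue. (\<lambda>n. g n x) \<longlonglongrightarrow> 0"
    and e: "0 < e"
  shows "eventually (\<lambda>n. lux_norm_enn p (g n) \<le> ennreal e) sequentially"
proof -
  have fin': "modular (\<lambda>x. ennreal (1 / e) * G x) < \<infinity>"
    using e fin lux_norm_cmult_le[of "1 / e" G]
    by (intro modular_finite) (auto simp: ennreal_mult_less_top less_top intro: le_less_trans)
  have "(\<lambda>n. \<integral>\<^sup>+ x. enn_pow (g n x / ennreal e) (p x) \<partial>lebesgue) \<longlonglongrightarrow> (\<integral>\<^sup>+ (x::'a). 0 \<partial>lebesgue)"
  proof (rule nn_integral_dominated_convergence)
    show "(\<integral>\<^sup>+ x. enn_pow (ennreal (1 / e) * G x) (p x) \<partial>lebesgue) < \<infinity>"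
      using fin' by (simp add: modular_def)
    show "AE x in lebesgue. enn_pow (g n x / ennreal e) (p x) \<le> enn_pow (ennreal (1 / e) * G x) (p x)" for n
      using AE_exponent_pos dom[of n]
      by eventually_elim (use e in \<open>auto simp: divide_ennreal_real intro!: enn_pow_mono mult_left_mono\<close>)
    show "AE x in lebesgue. (\<lambda>n. enn_pow (g n x / ennreal e) (p x)) \<longlonglongrightarrow> 0"
      using AE_exponent_pos lim
    proof eventually_elim
      case (elim x)
      have ev: "eventually (\<lambda>n. g n x < top) sequentially"
        using order_tendstoD(2)[OF elim(2), of top] by simp
      have "(\<lambda>n. enn2real (g n x)) \<longlonglongrightarrow> enn2real 0"
        using elim(2) by (intro tendsto_enn2real) auto
      then have "(\<lambda>n. ennreal ((1 / e) powr p x) * ennreal (enn2real (g n x) powr p x)) 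
          \<longlonglongrightarrow> ennreal ((1 / e) powr p x) * ennreal (0 powr p x)"
        using elim(1) by (intro ennreal_tendsto_cmult tendsto_ennrealI tendsto_powr')
          (auto intro!: always_eventually)
      moreover have "eventually (\<lambda>n. ennreal ((1 / e) powr p x) * ennreal (enn2real (g n x) powr p x)
          = enn_pow (g n x / ennreal e) (p x)) sequentially"
        using ev
      proof eventually_elim
        case (elim n)
        then show ?case
          using e by (simp add: divide_ennreal_real enn_pow_cmult) (simp add: enn_pow_def less_top)
      qed
      ultimately show ?case
        using elim(1) by (simp add: tendsto_cong)
    qed
  qed auto
  then have "eventually (\<lambda>n. modular (\<lambda>x. g n x / ennreal e) < 1) sequentially"
    unfolding modular_def by (intro order_tendstoD(2)) auto
  then show ?thesis
    by eventually_elim (use e in \<open>auto intro!: lux_norm_enn_le\<close>)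
qed

end

subsection \<open>Averages over balls of a small radius\<close>

lemma cube_eq_cbox: "cube c r = cbox (c - r *\<^sub>R One) (c + r *\<^sub>R One)"
  by (auto simp: cube_def mem_box inner_simps abs_le_iff algebra_simps)

lemma cube_measurable [measurable]: "cube c r \<in> sets lebesgue"
  by (simp add: cube_eq_cbox)

lemma emeasure_cube:
  "0 < r \<Longrightarrow> emeasure lebesgue (cube (c::'a::euclidean_space) r) = ennreal ((2 * r) ^ DIM('a))"
  by (simp add: cube_eq_cbox emeasure_lborel_cbox_eq inner_simps)

lemma norm_le_of_mem_cube:
  fixes c x :: "'a::euclidean_space" and r :: real
  assumes "x \<in> cube c r"
  shows "norm (x - c) \<le> DIM('a) * r"
proof -
  have "norm (x - c) \<le> (\<Sum>i\<in>Basis. \<bar>(x - c) \<bullet> i\<bar>)" by (rule norm_le_l1)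
  also have "\<dots> \<le> (\<Sum>i\<in>(Basis::'a set). r)"
    using assms by (intro sum_mono) (auto simp: cube_def inner_simps)
  finally show ?thesis by simp
qed

lemma emeasure_ball_lebesgue:
  "0 < r \<Longrightarrow> emeasure lebesgue (ball (c::'a::euclidean_space) r) = ennreal (measure lborel (ball (0::'a) 1) * r ^ DIM('a))"
  using emeasure_lborel_ball_finite[of c r]
  by (subst emeasure_eq_ennreal_measure) (auto simp: content_ball_conv_unit_ball[of r c] mult.commute)

lemma content_unit_ball_pos: "0 < measure lborel (ball (0::'a::euclidean_space) 1)"
  by (rule content_ball_pos) simp

text \<open>Hoelder's inequality on one cube, in modular form: the quantity \<open>\<alpha> powr (1 / S)\<close> plays the
  role of the norm of \<open>f v\<close> on \<open>Q\<close>, and \<open>l\<close>, \<open>m\<close> those of the norms of \<open>v\<close> and \<open>1 / v\<close>.\<close>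

lemma (in bdd_exponent) cube_modular_estimate:
  fixes f :: "'a \<Rightarrow> ennreal" and v :: "'a \<Rightarrow> real"
  assumes a: "1 < a" and [measurable]: "v \<in> borel_measurable lebesgue" "f \<in> borel_measurable lebesgue"
    "Q \<in> sets lebesgue"
    and v0: "\<And>x. 0 \<le> v x" and v_pos: "AE x in lebesgue. 0 < v x"
    and lm: "0 < l" "0 < m" "l * m \<le> C * V" and V: "0 < V" and C: "1 \<le> C"
    and l: "(\<integral>\<^sup>+ x. enn_pow (ennreal (v x * indicator Q x) / ennreal l) (p x) \<partial>lebesgue) \<le> 1"
    and m: "(\<integral>\<^sup>+ x. enn_pow (ennreal (indicator Q x / v x) / ennreal m) (conj_exp p x) \<partial>lebesgue) \<le> 1"
    and S: "0 < S" "\<And>x. x \<in> Q \<Longrightarrow> s \<le> p x \<and> p x \<le> S"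
    and \<alpha>: "0 \<le> \<alpha>" "\<alpha> \<le> 1"
      "(\<integral>\<^sup>+ x. enn_pow (f x * ennreal (v x)) (p x) * indicator Q x \<partial>lebesgue) = ennreal \<alpha>"
  shows "(\<integral>\<^sup>+ x. enn_pow ((\<integral>\<^sup>+ y\<in>Q. f y \<partial>lebesgue) / ennreal V * ennreal (v x)) (p x) * indicator Q x \<partial>lebesgue)
    \<le> ennreal ((2 * C) powr b * \<alpha> powr (s / S))"
proof (cases "\<alpha> = 0")
  \<comment> \<open>For \<alpha> = 0 the scale \<open>d\<close> below would vanish; but then f is
    zero almost everywhere on Q, and its mean is zero.\<close>
  case True
  then have "AE x in lebesgue. enn_pow (f x * ennreal (v x)) (p x) * indicator Q x = 0"
    using \<alpha>(3) by (subst nn_integral_0_iff_AE[symmetric]) auto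
  then have "AE x in lebesgue. f x * indicator Q x = 0"
    using v_pos by eventually_elim (auto simp: enn_pow_def enn2real_eq_0_iff split: if_splits)
  then have "(\<integral>\<^sup>+ y\<in>Q. f y \<partial>lebesgue) = 0"
    by (subst nn_integral_0_iff_AE) auto
  then show ?thesis by simp
next
  case False
  \<comment> \<open>Since d <= 1 and p <= S on Q, d^p is at least d^S = \<alpha>; hence the integral
    of (f v / d)^p over Q is at most 1.\<close>
  define d where "d = \<alpha> powr (1 / S)"
  have d: "0 < d" "d \<le> 1" and dS: "d powr S = \<alpha>" and ds: "d powr s = \<alpha> powr (s / S)"
    using False \<alpha> S by (auto simp: d_def powr_powr powr_le1)
  have young: "f x \<le> ennreal (d * m) * (enn_pow (f x * ennreal (v x)) (p x) * ennreal (1 / \<alpha>)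
      + enn_pow (ennreal (1 / v x) / ennreal m) (conj_exp p x))"
    if x: "x \<in> Q" "a \<le> p x" "0 < v x" for x
  proof (cases "f x")
    case (real t)
    let ?s = "p x" and ?s' = "conj_exp p x"
    have s: "1 < ?s" using x a by simp
    have s': "1 < ?s'" "1 / ?s + 1 / ?s' = 1"
      using s by (auto simp: conj_exp_def field_simps)
    \<comment> \<open>Young's inequality is applied to the normalised factors t v / d and 1 / (v m);
      the weight cancels in their product.\<close>
    have "t = d * m * ((t * v x / d) * (1 / v x / m))"
      using d lm x by simp
    also have "\<dots> \<le> d * m * ((t * v x / d) powr ?s / ?s + (1 / v x / m) powr ?s' / ?s')"
      using s s' real d x lm by (intro mult_left_mono Youngs_inequality) auto
    also have "\<dots> \<le> d * m * ((t * v x) powr ?s * (1 / \<alpha>) + (1 / v x / m) powr ?s')"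
    proof (intro mult_left_mono add_mono)
      have "(t * v x / d) powr ?s / ?s \<le> (t * v x / d) powr ?s / 1"
        using s by (intro divide_left_mono) auto
      also have "\<dots> = (t * v x) powr ?s * (1 / d powr ?s)"
        using real x d by (simp add: powr_divide)
      also have "\<dots> \<le> (t * v x) powr ?s * (1 / \<alpha>)"
        unfolding dS[symmetric] using d S(2)[OF x(1)]
        by (intro mult_left_mono divide_left_mono powr_mono') auto
      finally show "(t * v x / d) powr ?s / ?s \<le> (t * v x) powr ?s * (1 / \<alpha>)" .
      have "(1 / v x / m) powr ?s' / ?s' \<le> (1 / v x / m) powr ?s' / 1"
        using s' by (intro divide_left_mono) auto
      then show "(1 / v x / m) powr ?s' / ?s' \<le> (1 / v x / m) powr ?s'" by simp
    qed (use d lm in auto)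
    finally have *: "ennreal t \<le> ennreal (d * m * ((t * v x) powr ?s * (1 / \<alpha>) + (1 / v x / m) powr ?s'))"
      by (rule ennreal_leI)
    have 1: "enn_pow (f x * ennreal (v x)) ?s = ennreal ((t * v x) powr ?s)"
      using real x by (simp add: enn_pow_ennreal flip: ennreal_mult)
    have 2: "enn_pow (ennreal (1 / v x) / ennreal m) ?s' = ennreal ((1 / v x / m) powr ?s')"
      using x lm by (simp add: enn_pow_ennreal divide_ennreal)
    show ?thesis
      unfolding 1 2 unfolding real(2) using * d lm \<alpha> False
      by (simp only: ennreal_mult''[symmetric] ennreal_plus[symmetric] zero_le_divide_1_iff
          powr_ge_zero mult_nonneg_nonneg add_nonneg_nonneg)
  next
    case top
    then show ?thesis
      using x d lm \<alpha> False by (simp add: ennreal_top_mult ennreal_mult_top)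
  qed
  have conj_meas [measurable]: "conj_exp p \<in> borel_measurable lebesgue"
    unfolding conj_exp_def[abs_def] by measurable
  have "(\<integral>\<^sup>+ y\<in>Q. f y \<partial>lebesgue) \<le> (\<integral>\<^sup>+ x. ennreal (d * m) *
      (enn_pow (f x * ennreal (v x)) (p x) * indicator Q x * ennreal (1 / \<alpha>)
      + enn_pow (ennreal (indicator Q x / v x) / ennreal m) (conj_exp p x)) \<partial>lebesgue)"
    by (rule nn_integral_mono_AE, use AE_exponent v_pos in eventually_elim)
       (use young in \<open>auto simp: indicator_def\<close>)
  also have "\<dots> = ennreal (d * m) * ((\<integral>\<^sup>+ x. enn_pow (f x * ennreal (v x)) (p x) * indicator Q x \<partial>lebesgue) * ennreal (1 / \<alpha>)
      + (\<integral>\<^sup>+ x. enn_pow (ennreal (indicator Q x / v x) / ennreal m) (conj_exp p x) \<partial>lebesgue))"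
    by (simp add: nn_integral_cmult nn_integral_multc nn_integral_add)
  also have "\<dots> \<le> ennreal (d * m) * (ennreal \<alpha> * ennreal (1 / \<alpha>) + 1)"
    unfolding \<alpha>(3) using m by (intro mult_left_mono add_mono) auto
  also have "\<dots> = ennreal (d * m) * ennreal 2"
    using \<alpha> False by (simp flip: ennreal_mult)
  also have "\<dots> = ennreal (2 * d * m)"
    using d lm by (subst ennreal_mult''[symmetric]) (auto simp: mult_ac)
  finally have J: "(\<integral>\<^sup>+ y\<in>Q. f y \<partial>lebesgue) \<le> ennreal (2 * d * m)" .
  have "(\<integral>\<^sup>+ y\<in>Q. f y \<partial>lebesgue) / ennreal V \<le> ennreal (2 * d * m) / ennreal V"
    by (rule divide_right_mono_ennreal[OF J])
  also have "\<dots> = ennreal (2 * d * m / V)"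
    using d lm V by (simp add: divide_ennreal)
  \<comment> \<open>The Muckenhoupt bound l m <= C V trades m / V for C / l, and l is a scale at
    which v has modular at most 1 on Q.\<close>
  also have "\<dots> \<le> ennreal (2 * C * d / l)"
    using lm V d by (intro ennreal_leI) (auto simp: field_simps)
  finally have J': "(\<integral>\<^sup>+ y\<in>Q. f y \<partial>lebesgue) / ennreal V \<le> ennreal (2 * C * d / l)" .
  have "(\<integral>\<^sup>+ x. enn_pow ((\<integral>\<^sup>+ y\<in>Q. f y \<partial>lebesgue) / ennreal V * ennreal (v x)) (p x) * indicator Q x \<partial>lebesgue)
    \<le> (\<integral>\<^sup>+ x. ennreal ((2 * C) powr b * d powr s) * enn_pow (ennreal (v x * indicator Q x) / ennreal l) (p x) \<partial>lebesgue)"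
  proof (rule nn_integral_mono_AE, use AE_exponent in eventually_elim)
    fix x assume p: "a \<le> p x \<and> p x \<le> b"
    show "enn_pow ((\<integral>\<^sup>+ y\<in>Q. f y \<partial>lebesgue) / ennreal V * ennreal (v x)) (p x) * indicator Q x \<le>
       ennreal ((2 * C) powr b * d powr s) * enn_pow (ennreal (v x * indicator Q x) / ennreal l) (p x)"
    proof (cases "x \<in> Q")
      case True
      have "enn_pow ((\<integral>\<^sup>+ y\<in>Q. f y \<partial>lebesgue) / ennreal V * ennreal (v x)) (p x)
          \<le> enn_pow (ennreal (2 * C * d / l) * ennreal (v x)) (p x)"
        using p a by (intro enn_pow_mono mult_right_mono J') auto
      also have "\<dots> = enn_pow (ennreal (2 * C * d) * (ennreal (v x) / ennreal l)) (p x)"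
        using lm d C by (simp add: divide_ennreal_real flip: mult.assoc ennreal_mult)
      also have "\<dots> = ennreal ((2 * C * d) powr p x) * enn_pow (ennreal (v x) / ennreal l) (p x)"
        using C d by (intro enn_pow_cmult) auto
      also have "\<dots> \<le> ennreal ((2 * C) powr b * d powr s) * enn_pow (ennreal (v x) / ennreal l) (p x)"
      proof (intro mult_right_mono ennreal_leI)
        have "(2 * C * d) powr p x = (2 * C) powr p x * d powr p x"
          by (rule powr_mult)
        \<comment> \<open>Here d <= 1 is combined with the lower bound s <= p, whereas the
          normalisation used p <= S: hence the exponent s / S in place of 1.\<close>
        also have "\<dots> \<le> (2 * C) powr b * d powr s"
          using p S(2)[OF True] d C by (intro mult_mono powr_mono powr_mono') auto
        finally show "(2 * C * d) powr p x \<le> (2 * C) powr b * d powr s" .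
      qed simp
      finally show ?thesis using True by simp
    qed simp
  qed
  also have "\<dots> = ennreal ((2 * C) powr b * d powr s) * (\<integral>\<^sup>+ x. enn_pow (ennreal (v x * indicator Q x) / ennreal l) (p x) \<partial>lebesgue)"
    by (rule nn_integral_cmult) measurable
  also have "\<dots> \<le> ennreal ((2 * C) powr b * d powr s) * 1"
    by (intro mult_left_mono l) auto
  finally show ?thesis by (simp add: ds)
qed

text \<open>The factor \<alpha>^(-e) is unbounded as \<alpha> tends to 0. Replacing \<alpha> by the
  maximum M of \<alpha> and the floor T costs only an additive T, and then M^(-e) <= T^(-d) <=
  E.\<close>

lemma powr_one_minus_le:
  fixes \<alpha> T e d E :: real
  assumes "0 \<le> \<alpha>" "0 < T" "T \<le> 1" "0 \<le> e" "e \<le> d" "e \<le> 1" "T powr (- d) \<le> E"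
  shows "\<alpha> powr (1 - e) \<le> E * (\<alpha> + T)"
proof -
  let ?M = "max \<alpha> T"
  have M: "0 < ?M" "T \<le> ?M" "?M \<le> \<alpha> + T" using assms by auto
  have "\<alpha> powr (1 - e) \<le> ?M powr (1 - e)"
    using assms by (intro powr_mono2) auto
  also have "\<dots> = ?M powr (- e) * ?M"
    using M by (simp add: powr_diff powr_minus field_simps)
  also have "\<dots> \<le> T powr (- e) * ?M"
    using assms M by (intro mult_right_mono powr_mono2') auto
  also have "\<dots> \<le> T powr (- d) * ?M"
    using assms M by (intro mult_right_mono powr_mono') auto
  also have "\<dots> \<le> E * (\<alpha> + T)"
    using assms M by (intro mult_mono) (auto intro: order_trans[OF powr_ge_zero])
  finally show ?thesis .
qed

lemma ball_lebesgue_measurable [measurable]: "ball c r \<in> sets lebesgue"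
  by simp

lemma not_AE_not_mem_cube:
  assumes "0 < r"
  shows "\<not> (AE x in lebesgue. x \<notin> cube c r)"
proof
  assume "AE x in lebesgue. x \<notin> cube c r"
  then have "cube c r \<in> null_sets lebesgue" by (simp add: AE_iff_null_sets)
  then show False using emeasure_cube[OF assms, of c] assms by (auto simp: null_sets_def)
qed

text \<open>Replaces the product of two norms by explicit admissible scales. Both norms are positive
  because v > 0 almost everywhere and a cube is not null, so a finite product forces both to be
  finite.\<close>

lemma A_var_witness:
  fixes s v :: "'a::euclidean_space \<Rightarrow> real"
  assumes A: "A_var s v" and [measurable]: "v \<in> borel_measurable lebesgue"
    and v0: "\<And>x. 0 \<le> v x" and v_pos: "AE x in lebesgue. 0 < v x"
  obtains C where "1 \<le> C"
    "\<And>c r. 0 < r \<Longrightarrow> \<exists>l>0. \<exists>m>0. l * m \<le> C * (2 * r) ^ DIM('a) \<and>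
      (\<integral>\<^sup>+ x. enn_pow (ennreal (v x * indicator (cube c r) x) / ennreal l) (s x) \<partial>lebesgue) \<le> 1 \<and>
      (\<integral>\<^sup>+ x. enn_pow (ennreal (indicator (cube c r) x / v x) / ennreal m) (conj_exp s x) \<partial>lebesgue) \<le> 1"
proof -
  have P: "in_P s" and ex: "\<exists>C::real. \<forall>c r. r > 0 \<longrightarrow>
     lux_norm s (\<lambda>x. v x * indicator (cube c r) x)
       * lux_norm (conj_exp s) (\<lambda>x. indicator (cube c r) x / v x)
     \<le> ennreal C * emeasure lebesgue (cube c r)"
    using A unfolding A_var_def by (rule conjunct1, rule conjunct2)
  obtain C where C: "\<And>c r. 0 < r \<Longrightarrow> lux_norm s (\<lambda>x. v x * indicator (cube c r) x)
       * lux_norm (conj_exp s) (\<lambda>x. indicator (cube c r) x / v x)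
     \<le> ennreal C * emeasure lebesgue (cube c r)"
    using ex by blast
  have [measurable]: "s \<in> borel_measurable lebesgue"
    using P by (simp add: in_P_def)
  obtain a b where a: "1 < a" "AE x in lebesgue. a \<le> s x" and b: "AE x in lebesgue. s x \<le> b"
    using P unfolding in_P_def by blast
  interpret s: bdd_exponent s a "max a b"
    using a b by unfold_locales (auto elim: eventually_elim2)
  have [measurable]: "conj_exp s \<in> borel_measurable lebesgue"
    unfolding conj_exp_def[abs_def] by measurable
  interpret s': bdd_exponent "conj_exp s" 1 "a / (a - 1)"
  proof
    show "AE x in lebesgue. 1 \<le> conj_exp s x \<and> conj_exp s x \<le> a / (a - 1)"
      using a(2) by eventually_elim (use a(1) in \<open>auto simp: conj_exp_def field_simps\<close>)
  qed (use a in \<open>auto simp: field_simps\<close>)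
  show thesis
  \<comment> \<open>Both norms are doubled so as to lie strictly above the infima, which gives 4 C;
    the maximum with 1 provides the promised lower bound.\<close>
  proof (rule that[of "max 1 (4 * C)"])
    fix c :: 'a and r :: real assume r: "0 < r"
    let ?g = "\<lambda>x. ennreal (v x * indicator (cube c r) x)"
    let ?h = "\<lambda>x. ennreal (indicator (cube c r) x / v x)"
    let ?X = "lux_norm_enn s ?g" and ?Y = "lux_norm_enn (conj_exp s) ?h"
    have XY: "?X * ?Y \<le> ennreal C * ennreal ((2 * r) ^ DIM('a))"
      using C[OF r, of c] v0 unfolding lux_norm_def emeasure_cube[OF r] by (simp add: abs_mult)
    have "?X \<noteq> 0"
    proof
      assume "?X = 0"
      then have "AE x in lebesgue. ?g x = 0" by (intro s.lux_norm_eq_0_AE) auto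
      then have "AE x in lebesgue. x \<notin> cube c r"
        using v_pos by eventually_elim (auto simp: indicator_def split: if_splits)
      with not_AE_not_mem_cube[OF r] show False by blast
    qed
    moreover have "?Y \<noteq> 0"
    proof
      assume "?Y = 0"
      then have "AE x in lebesgue. ?h x = 0" by (intro s'.lux_norm_eq_0_AE) auto
      then have "AE x in lebesgue. x \<notin> cube c r"
        using v_pos by eventually_elim (auto simp: indicator_def split: if_splits)
      with not_AE_not_mem_cube[OF r] show False by blast
    qed
    moreover have "?X * ?Y < top"
      using XY by (rule order.strict_trans1) (simp add: ennreal_mult_less_top)
    ultimately obtain x y where x: "?X = ennreal x" "0 < x" and y: "?Y = ennreal y" "0 < y"
      by (cases ?X; cases ?Y) (auto simp: ennreal_top_mult ennreal_mult_top less_le)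
    have "x * y \<le> C * (2 * r) ^ DIM('a)"
    proof (cases "0 \<le> C")
      case True
      then show ?thesis using XY x y r by (simp flip: ennreal_mult)
    next
      case False
      then have "ennreal (x * y) \<le> 0"
        using XY x y by (simp add: ennreal_neg flip: ennreal_mult)
      then show ?thesis using x(2) y(2) by auto
    qed
    then have "2 * x * (2 * y) \<le> 4 * C * (2 * r) ^ DIM('a)" by simp
    also have "\<dots> \<le> max 1 (4 * C) * (2 * r) ^ DIM('a)"
      using r by (intro mult_right_mono) auto
    finally have "2 * x * (2 * y) \<le> max 1 (4 * C) * (2 * r) ^ DIM('a)" .
    moreover have "(\<integral>\<^sup>+ z. enn_pow (?g z / ennreal (2 * x)) (s z) \<partial>lebesgue) \<le> 1"
      using x by (intro s.modular_le_one[unfolded s.modular_def]) (simp add: ennreal_less_iff)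
    moreover have "(\<integral>\<^sup>+ z. enn_pow (?h z / ennreal (2 * y)) (conj_exp s z) \<partial>lebesgue) \<le> 1"
      using y by (intro s'.modular_le_one[unfolded s'.modular_def]) (simp add: ennreal_less_iff)
    ultimately show "\<exists>l>0. \<exists>m>0. l * m \<le> max 1 (4 * C) * (2 * r) ^ DIM('a) \<and>
      (\<integral>\<^sup>+ x. enn_pow (?g x / ennreal l) (s x) \<partial>lebesgue) \<le> 1 \<and>
      (\<integral>\<^sup>+ x. enn_pow (?h x / ennreal m) (conj_exp s x) \<partial>lebesgue) \<le> 1"
      using x y by (intro exI[of _ "2 * x"] exI[of _ "2 * y"] conjI) auto
  qed simp
qed

section \<open>A grid of overlapping cubes\<close>

definition lattice_point :: "real \<Rightarrow> ('a::euclidean_space \<Rightarrow> int) \<Rightarrow> 'a" where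
  "lattice_point h k = (\<Sum>i\<in>Basis. (h * of_int (k i)) *\<^sub>R i)"

text \<open>Extensional functions, so that the indices are countable; this is what lets sums over
  the grid be exchanged with integrals.\<close>

definition lattice_index :: "('a::euclidean_space \<Rightarrow> int) set" where
  "lattice_index = Pi\<^sub>E Basis (\<lambda>_. UNIV)"

lemma countable_lattice_index [simp]: "countable lattice_index"
  unfolding lattice_index_def by (rule countable_PiE) auto

lemma inner_lattice_point [simp]: "i \<in> Basis \<Longrightarrow> lattice_point h k \<bullet> i = h * of_int (k i)"
  by (simp add: lattice_point_def inner_sum_left_Basis)

lemma lattice_cover:
  fixes x :: "'a::euclidean_space"
  assumes "0 < h"
  obtains k where "k \<in> lattice_index" "x \<in> cube (lattice_point h k) h"
proof
  let ?k = "restrict (\<lambda>i. \<lfloor>x \<bullet> i / h\<rfloor>) Basis"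
  show "?k \<in> lattice_index" by (auto simp: lattice_index_def)
  have "\<bar>x \<bullet> i - h * of_int \<lfloor>x \<bullet> i / h\<rfloor>\<bar> \<le> h" for i
  proof -
    have "of_int \<lfloor>x \<bullet> i / h\<rfloor> * h \<le> x \<bullet> i" "x \<bullet> i \<le> (of_int \<lfloor>x \<bullet> i / h\<rfloor> + 1) * h"
      using assms by (subst pos_le_divide_eq[symmetric] pos_divide_le_eq[symmetric]; linarith)+
    then show ?thesis using assms by (simp add: algebra_simps abs_le_iff)
  qed
  then show "x \<in> cube (lattice_point h ?k) h" by (auto simp: cube_def)
qed

text \<open>In each coordinate \<open>k i\<close> lies in a closed interval of length 4, which holds
  at most 5 integers. The count is written as an integral over the counting measure, the form in
  which it appears once sum and integral are exchanged.\<close>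

lemma lattice_overlap:
  fixes x :: "'a::euclidean_space"
  assumes h: "0 < h"
  shows "(\<integral>\<^sup>+ k. indicator (cube (lattice_point h k) (2 * h)) x \<partial>count_space lattice_index) \<le> ennreal (5 ^ DIM('a))"
proof -
  let ?A = "{k \<in> lattice_index. x \<in> cube (lattice_point h k) (2 * h)}"
  define S where "S i = {\<lceil>x \<bullet> i / h - 2\<rceil>..\<lfloor>x \<bullet> i / h + 2\<rfloor>}" for i
  have "?A \<subseteq> Pi\<^sub>E Basis S"
  proof
    fix k assume k: "k \<in> ?A"
    have "k i \<in> S i" if "i \<in> Basis" for i
    proof -
      have "\<bar>x \<bullet> i - h * of_int (k i)\<bar> \<le> 2 * h" using k that by (auto simp: cube_def)
      then have "x \<bullet> i / h - 2 \<le> of_int (k i)" "of_int (k i) \<le> x \<bullet> i / h + 2"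
        using h by (auto simp: field_simps abs_le_iff)
      then show ?thesis unfolding S_def atLeastAtMost_iff ceiling_le_iff le_floor_iff by simp
    qed
    then show "k \<in> Pi\<^sub>E Basis S" using k by (auto simp: lattice_index_def PiE_iff)
  qed
  moreover have fin: "finite (Pi\<^sub>E (Basis::'a set) S)" by (intro finite_PiE) (auto simp: S_def)
  ultimately have fA: "finite ?A" and cA: "card ?A \<le> card (Pi\<^sub>E (Basis::'a set) S)"
    by (auto intro: finite_subset card_mono)
  note cA
  also have "\<dots> = (\<Prod>i\<in>(Basis::'a set). card (S i))" by (simp add: card_PiE)
  also have "\<dots> \<le> (\<Prod>i\<in>(Basis::'a set). 5)"
  proof (intro prod_mono conjI)
    fix i :: 'a
    have "\<lfloor>x \<bullet> i / h + 2\<rfloor> - \<lceil>x \<bullet> i / h - 2\<rceil> + 1 \<le> 5" by linarith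
    then show "card (S i) \<le> 5"
      unfolding S_def by (simp only: card_atLeastAtMost_int nat_le_iff of_nat_numeral)
  qed simp
  finally have c: "card ?A \<le> 5 ^ DIM('a)" by simp
  have "(\<integral>\<^sup>+ k. indicator (cube (lattice_point h k) (2 * h)) x \<partial>count_space lattice_index)
      = (\<integral>\<^sup>+ k. indicator ?A k \<partial>count_space lattice_index)"
    by (intro nn_integral_cong) (auto simp: indicator_def)
  also have "\<dots> = of_nat (card ?A)"
    using fA by (subst nn_integral_indicator) (auto simp: emeasure_count_space_finite)
  also have "\<dots> \<le> ennreal (5 ^ DIM('a))"
    using c by (metis ennreal_of_nat_eq_real_of_nat ennreal_leI of_nat_le_iff of_nat_numeral of_nat_power)
  finally show ?thesis .
qed

section \<open>Summability at infinity and log-Hoelder continuity\<close>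

lemma decay_integrable:
  "(\<integral>\<^sup>+ x. ennreal (1 / (exp 1 + norm (x::'a::euclidean_space)) ^ (DIM('a) + 1)) \<partial>lebesgue) < \<infinity>"
proof -
  let ?n = "DIM('a)"
  let ?\<omega> = "measure lborel (ball (0::'a) 1)"
  \<comment> \<open>Dyadic balls: where 2^k <= e + |x| < 2^(k+1) the integrand is at most 2^(-k
    (n+1)), while the ball has volume of order 2^(k n), so the series is geometric with ratio
    1/2.\<close>
  let ?t = "\<lambda>k x. ennreal (1 / (2 ^ k) ^ (?n + 1)) * indicator (ball (0::'a) (2 ^ (k + 1))) x"
  have "ennreal (1 / (exp 1 + norm x) ^ (?n + 1)) \<le> (\<Sum>k. ?t k x)" for x :: 'a
  proof -
    define k where "k = nat \<lfloor>log 2 (exp 1 + norm x)\<rfloor>"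
    have e: "1 \<le> exp 1 + norm x"
      using exp_ge_add_one_self[of 1] norm_ge_zero[of x] by linarith
    then have "0 \<le> log 2 (exp 1 + norm x)" by simp
    then have "real k \<le> log 2 (exp 1 + norm x)" "log 2 (exp 1 + norm x) < real k + 1"
      unfolding k_def by linarith+
    then have "2 powr real k \<le> exp 1 + norm x" "exp 1 + norm x < 2 powr (real k + 1)"
      using e by (auto simp: le_log_iff log_less_iff)
    then have k: "2 ^ k \<le> exp 1 + norm x" "exp 1 + norm x < 2 ^ (k + 1)"
      by (auto simp: powr_realpow powr_add)
    have "norm x < 2 ^ (k + 1)" using k(2) exp_gt_zero[of "1::real"] by linarith
    then have "x \<in> ball 0 (2 ^ (k + 1))" by simp
    moreover have "1 / (exp 1 + norm x) ^ (?n + 1) \<le> 1 / (2 ^ k) ^ (?n + 1)"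
      using k e by (intro divide_left_mono power_mono) (auto simp del: power_Suc)
    ultimately have "ennreal (1 / (exp 1 + norm x) ^ (?n + 1)) \<le> ?t k x"
      by (simp add: ennreal_leI del: power_Suc)
    also have "\<dots> \<le> (\<Sum>k. ?t k x)"
      using sum_le_suminf[OF summableI, of "{k}" "\<lambda>k. ?t k x"] by (simp only: finite.intros sum.insert_remove Diff_empty sum.empty) simp
    finally show ?thesis .
  qed
  then have "(\<integral>\<^sup>+ x. ennreal (1 / (exp 1 + norm (x::'a)) ^ (?n + 1)) \<partial>lebesgue) \<le> (\<integral>\<^sup>+ x. (\<Sum>k. ?t k x) \<partial>lebesgue)"
    by (rule nn_integral_mono)
  also have "\<dots> = (\<Sum>k. \<integral>\<^sup>+ x. ?t k x \<partial>lebesgue)"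
    by (rule nn_integral_suminf) measurable
  also have "\<dots> = (\<Sum>k. ennreal (?\<omega> * 2 ^ ?n * (1 / 2) ^ k))"
  proof (rule suminf_cong)
    fix k
    have "(\<integral>\<^sup>+ x. ?t k x \<partial>lebesgue) = ennreal (1 / (2 ^ k) ^ (?n + 1)) * emeasure lebesgue (ball (0::'a) (2 ^ (k + 1)))"
      by (subst nn_integral_cmult_indicator) auto
    also have "\<dots> = ennreal (1 / (2 ^ k) ^ (?n + 1)) * ennreal (?\<omega> * (2 ^ (k + 1)) ^ ?n)"
      by (subst emeasure_ball_lebesgue) simp_all
    also have "\<dots> = ennreal (1 / (2 ^ k) ^ (?n + 1) * (?\<omega> * (2 ^ (k + 1)) ^ ?n))"
      by (rule ennreal_mult'[symmetric]) simp
    also have "1 / (2 ^ k) ^ (?n + 1) * (?\<omega> * (2 ^ (k + 1)) ^ ?n) = ?\<omega> * 2 ^ ?n * (1 / 2) ^ k"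
      by (simp add: power_mult_distrib power_add field_simps)
    finally show "(\<integral>\<^sup>+ x. ?t k x \<partial>lebesgue) = ennreal (?\<omega> * 2 ^ ?n * (1 / 2) ^ k)" .
  qed
  also have "\<dots> = ennreal (?\<omega> * 2 ^ ?n * (1 / (1 - 1 / 2)))"
    by (rule suminf_ennreal_eq, simp, rule sums_mult, rule geometric_sums) simp
  also have "\<dots> < \<infinity>" by simp
  finally show ?thesis .
qed

text \<open>The two conditions give two bounds for the oscillation of s on the cube, and \<delta> is
  their minimum. In -2 \<delta> ln T the part with -ln h is controlled by the local bound and the
  part with ln (e + |c|) by the one at infinity, so E depends on neither h nor c.\<close>

lemma LH_oscillation:
  fixes s :: "'a::euclidean_space \<Rightarrow> real"
  assumes "in_LH s"
  obtains r0 E where "0 < r0" "1 \<le> E"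
    "\<And>h c. 0 < h \<Longrightarrow> h < r0 \<Longrightarrow> \<exists>\<delta>\<ge>0. \<delta> \<le> 1 / 2 \<and>
      (\<forall>x\<in>cube c (2 * h). \<bar>s x - s c\<bar> \<le> \<delta> \<and> norm (x - c) \<le> 1) \<and>
      h ^ DIM('a) / (exp 1 + norm c) ^ (DIM('a) + 1) \<le> 1 \<and>
      (h ^ DIM('a) / (exp 1 + norm c) ^ (DIM('a) + 1)) powr (- (2 * \<delta>)) \<le> E"
proof -
  let ?n = "real DIM('a)"
  obtain C0 Ci pinf where C: "0 < C0" "0 < Ci"
    and C0: "\<And>x y. norm (x - y) < 1/2 \<Longrightarrow> \<bar>s x - s y\<bar> \<le> C0 / (- ln (norm (x - y)))"
    and Ci: "\<And>x. \<bar>s x - pinf\<bar> \<le> Ci / ln (exp 1 + norm x)"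
    using assms unfolding in_LH_def by blast
  have n: "1 \<le> ?n" using DIM_positive[where 'a='a] by (simp add: Suc_le_eq)
  \<comment> \<open>With d = 2 n h, which bounds the distance of points of the cube from c, the
    three entries ensure in turn d^2 <= h, hence -ln h <= -2 ln d; -ln d >= 2 C0, hence \<delta> <=
    1/2; and d < 1/2, where the local condition applies.\<close>
  define r0 where "r0 = min (1 / (4 * ?n ^ 2)) (min (exp (- (2 * C0)) / (2 * ?n)) (1 / (8 * ?n)))"
  define E where "E = exp (4 * ?n * C0 + 6 * (?n + 1) * Ci)"
  have e: "1 \<le> exp (1::real)" by simp
  show thesis
  proof (rule that)
    show "0 < r0" using n by (simp add: r0_def)
    show "1 \<le> E" using n C by (simp add: E_def)
    fix h :: real and c :: 'a assume h: "0 < h" "h < r0"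
    define d where "d = 2 * ?n * h"
    let ?e = "\<lambda>x::'a. exp 1 + norm x"
    let ?T = "h ^ DIM('a) / ?e c ^ (DIM('a) + 1)"
    have d: "0 < d" "d < 1/2" "d < exp (- (2 * C0))" "d ^ 2 \<le> h" "h < 1"
    proof -
      show "0 < d" using h n by (simp add: d_def)
      have "h < 1 / (8 * ?n)" using h by (simp add: r0_def)
      then have "8 * ?n * h < 1" using n by (simp add: field_simps)
      then show "d < 1/2" by (simp add: d_def)
      have "1 * h \<le> ?n * h" using h n by (intro mult_right_mono) auto
      with \<open>8 * ?n * h < 1\<close> show "h < 1" using h by linarith
      have "h < exp (- (2 * C0)) / (2 * ?n)" using h by (simp add: r0_def)
      then show "d < exp (- (2 * C0))" using n by (simp add: d_def field_simps)
      have "h < 1 / (4 * ?n ^ 2)" using h by (simp add: r0_def)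
      then have "4 * ?n ^ 2 * h \<le> 1" using n by (simp add: field_simps)
      then have "4 * ?n ^ 2 * h * h \<le> 1 * h" using h by (intro mult_right_mono) auto
      then show "d ^ 2 \<le> h" by (simp add: d_def power2_eq_square algebra_simps)
    qed
    have ld: "2 * C0 \<le> - ln d" "0 < - ln d"
      using d C ln_mono[of d "exp (- (2 * C0))"] by auto
    have lh: "- ln h \<le> 2 * (- ln d)" "0 < - ln h"
      using ln_mono[OF d(4)] d h by (auto simp: ln_realpow)
    have le: "1 \<le> ln (?e x)" for x :: 'a
      using ln_mono[of "exp 1" "?e x"] by simp
    \<comment> \<open>The 3 comes from ln (e + |x|) >= ln (e + |c|) / 2 on the cube: the term at x
      contributes 2 Ci and the term at c one more.\<close>
    define \<delta> where "\<delta> = min (C0 / (- ln d)) (3 * Ci / ln (?e c))"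
    have \<delta>0: "0 \<le> \<delta>" 
      using C ld le[of c] unfolding \<delta>_def by (intro min.boundedI divide_nonneg_pos) auto
    have \<delta>1: "\<delta> \<le> 1 / 2"
    proof -
      have "C0 / (- ln d) \<le> 1 / 2" using ld by (simp only: pos_divide_le_eq)
      then show ?thesis by (simp add: \<delta>_def)
    qed
    have near: "\<bar>s x - s c\<bar> \<le> \<delta> \<and> norm (x - c) \<le> 1" if x: "x \<in> cube c (2 * h)" for x
    proof -
      have nx: "norm (x - c) \<le> d" using norm_le_of_mem_cube[OF x] by (simp add: d_def)
      have 1: "\<bar>s x - s c\<bar> \<le> C0 / (- ln d)"
      proof (cases "x = c")
        case True
        have "0 \<le> C0 / (- ln d)" using C ld by (intro divide_nonneg_pos) auto
        then show ?thesis using True by simp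
      next
        case False
        have "\<bar>s x - s c\<bar> \<le> C0 / (- ln (norm (x - c)))" using nx d by (intro C0) auto
        also have "\<dots> \<le> C0 / (- ln d)"
          using False nx d C ld by (intro divide_left_mono mult_pos_pos) (auto simp: ln_mono)
        finally show ?thesis .
      qed
      \<comment> \<open>The additive 1 is absorbed by squaring, which the logarithm turns into a
        factor 2.\<close>
      have "?e c \<le> ?e x + 1"
        using nx d norm_triangle_ineq2[of c x] by (simp add: norm_minus_commute)
      also have "\<dots> \<le> ?e x ^ 2"
      proof -
        have "2 \<le> ?e x" using exp_ge_add_one_self[of 1] norm_ge_zero[of x] by linarith
        then have "2 * ?e x \<le> ?e x * ?e x" by (intro mult_right_mono) auto
        with \<open>2 \<le> ?e x\<close> show ?thesis by (simp add: power2_eq_square)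
      qed
      finally have "ln (?e c) \<le> ln (?e x ^ 2)"
        by (intro ln_mono) (auto simp: add_pos_nonneg)
      also have "\<dots> = 2 * ln (?e x)" by (simp add: ln_realpow add_pos_nonneg)
      finally have le': "ln (?e c) / 2 \<le> ln (?e x)" by simp
      have "\<bar>s x - s c\<bar> \<le> \<bar>s x - pinf\<bar> + \<bar>s c - pinf\<bar>" by simp
      also have "\<dots> \<le> Ci / ln (?e x) + Ci / ln (?e c)" by (intro add_mono Ci)
      also have "\<dots> \<le> Ci / (ln (?e c) / 2) + Ci / ln (?e c)"
        using le' le[of c] le[of x] C by (intro add_mono divide_left_mono mult_pos_pos) auto
      also have "\<dots> = 3 * Ci / ln (?e c)" by simp
      finally show ?thesis using 1 nx d by (simp add: \<delta>_def)
    qed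
    have ec: "1 \<le> ?e c" using e by (simp add: add_increasing2)
    have T0: "0 < ?T" using h by (simp add: add_pos_nonneg)
    have T1: "?T \<le> 1"
    proof -
      have "h ^ DIM('a) \<le> 1" using h d by (intro power_le_one) auto
      also have "1 \<le> ?e c ^ (DIM('a) + 1)" using ec by (rule one_le_power)
      finally show ?thesis using ec by (simp only: divide_le_eq_1) auto
    qed
    have "ln ?T = ln (h ^ DIM('a)) - ln (?e c ^ (DIM('a) + 1))"
      using h ec by (simp only: ln_div) auto
    also have "\<dots> = ?n * ln h - (?n + 1) * ln (?e c)"
      using h ec by (subst (1 2) ln_realpow) auto
    finally have lnT: "ln ?T = ?n * ln h - (?n + 1) * ln (?e c)" .
    have "- (2 * \<delta>) * ln ?T = 2 * ?n * (\<delta> * (- ln h)) + 2 * (?n + 1) * (\<delta> * ln (?e c))"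
      unfolding lnT by (simp add: algebra_simps)
    also have "\<dots> \<le> 2 * ?n * (2 * C0) + 2 * (?n + 1) * (3 * Ci)"
    proof (intro add_mono mult_left_mono)
      have "\<delta> * (- ln h) \<le> (C0 / (- ln d)) * (2 * (- ln d))"
        using lh ld C by (intro mult_mono divide_nonneg_pos) (auto simp: \<delta>_def)
      also have "\<dots> = 2 * C0" using ld by simp
      finally show "\<delta> * (- ln h) \<le> 2 * C0" .
      have "\<delta> * ln (?e c) \<le> (3 * Ci / ln (?e c)) * ln (?e c)"
        using le[of c] by (intro mult_right_mono) (auto simp: \<delta>_def)
      also have "\<dots> = 3 * Ci" using le[of c] by simp
      finally show "\<delta> * ln (?e c) \<le> 3 * Ci" .
    qed (use n in auto)
    also have "\<dots> = 4 * ?n * C0 + 6 * (?n + 1) * Ci" by simp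
    finally have "?T powr (- (2 * \<delta>)) \<le> E"
      using T0 by (simp add: powr_def E_def)
    with \<delta>0 \<delta>1 near T1 show "\<exists>\<delta>\<ge>0. \<delta> \<le> 1 / 2 \<and>
      (\<forall>x\<in>cube c (2 * h). \<bar>s x - s c\<bar> \<le> \<delta> \<and> norm (x - c) \<le> 1) \<and> ?T \<le> 1 \<and> ?T powr (- (2 * \<delta>)) \<le> E"
      by blast
  qed
qed

lemma ball_subset_cube: "ball x r \<subseteq> cube x r"
proof
  fix y assume "y \<in> ball x r"
  then have "norm (y - x) < r" by (simp add: dist_norm norm_minus_commute)
  then have "\<bar>(y - x) \<bullet> i\<bar> \<le> r" if "i \<in> Basis" for i
    using Basis_le_norm[OF that, of "y - x"] by linarith
  then show "y \<in> cube x r" by (simp add: cube_def inner_simps)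
qed

lemma cube_trans: "x \<in> cube c r \<Longrightarrow> y \<in> cube x r' \<Longrightarrow> y \<in> cube c (r + r')"
  unfolding cube_def by (force simp: abs_le_iff)

definition ball_average :: "real \<Rightarrow> ('a::euclidean_space \<Rightarrow> ennreal) \<Rightarrow> 'a \<Rightarrow> ennreal" where
  "ball_average r f x = (\<integral>\<^sup>+ y\<in>ball x r. f y \<partial>lebesgue) / emeasure lebesgue (ball x r)"

text \<open>The Muckenhoupt condition gives the estimate on each cube of a grid with an exponent loss \<open>s / S < 1\<close>; log-Hoelder
  continuity turns the loss into a constant factor up to an error which decays fast
  enough at infinity to be summed over the grid.\<close>

lemma (in bdd_exponent) averaging_modular_bound:
  fixes v :: "'a \<Rightarrow> real"
  assumes a: "1 < a" and A: "A_var p v" and LH: "in_LH p" and [measurable]: "v \<in> borel_measurable lebesgue"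
    and v0: "\<And>x. 0 \<le> v x" and v_pos: "AE x in lebesgue. 0 < v x"
  obtains r0 D where "0 < r0" "1 \<le> D"
    "\<And>r f. 0 < r \<Longrightarrow> r < r0 \<Longrightarrow> f \<in> borel_measurable lebesgue \<Longrightarrow>
      modular (\<lambda>x. f x * ennreal (v x)) \<le> 1 \<Longrightarrow>
      modular (\<lambda>x. ball_average r f x * ennreal (v x)) \<le> ennreal D"
proof -
  let ?n = "DIM('a)"
  let ?\<omega> = "measure lborel (ball (0::'a) 1)"
  let ?dec = "\<lambda>x::'a. 1 / (exp 1 + norm x) ^ (?n + 1)"
  obtain C where C: "1 \<le> C"
    and CC: "\<And>c r. 0 < r \<Longrightarrow> \<exists>l>0. \<exists>m>0. l * m \<le> C * (2 * r) ^ DIM('a) \<and>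
      (\<integral>\<^sup>+ x. enn_pow (ennreal (v x * indicator (cube c r) x) / ennreal l) (p x) \<partial>lebesgue) \<le> 1 \<and>
      (\<integral>\<^sup>+ x. enn_pow (ennreal (indicator (cube c r) x / v x) / ennreal m) (conj_exp p x) \<partial>lebesgue) \<le> 1"
    using A_var_witness[OF A _ v0 v_pos] by auto
  obtain r0 E where r0: "0 < r0" and E: "1 \<le> E"
    and osc: "\<And>h c. 0 < h \<Longrightarrow> h < r0 \<Longrightarrow> \<exists>\<delta>\<ge>0. \<delta> \<le> 1 / 2 \<and>
      (\<forall>x\<in>cube c (2 * h). \<bar>p x - p c\<bar> \<le> \<delta> \<and> norm (x - c) \<le> 1) \<and>
      h ^ DIM('a) / (exp 1 + norm c) ^ (DIM('a) + 1) \<le> 1 \<and>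
      (h ^ DIM('a) / (exp 1 + norm c) ^ (DIM('a) + 1)) powr (- (2 * \<delta>)) \<le> E"
    using LH_oscillation[OF LH] by blast
  obtain W where W: "0 \<le> W" "(\<integral>\<^sup>+ x. ennreal (?dec x) \<partial>lebesgue) = ennreal W"
    using decay_integrable[where 'a='a] by (cases "\<integral>\<^sup>+ x. ennreal (?dec x) \<partial>lebesgue") auto
  have [measurable]: "(\<lambda>x::'a. x) \<in> borel_measurable lebesgue"
    by (intro measurable_completion) auto
  \<comment> \<open>4^n / \<omega> is the volume of a cube of side 4 h over that of a ball of radius
    h. The maximum with 1 makes \<kappa>^p <= \<kappa>^b.\<close>
  define \<kappa> where "\<kappa> = max 1 (4 ^ ?n / ?\<omega>)"
  define D1 where "D1 = \<kappa> powr b * ((2 * C) powr b * E)"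
  define D where "D = max 1 (D1 * (5 ^ ?n + 5 ^ ?n * (2 ^ (?n + 1) * W)))"
  have D1: "0 \<le> D1" using E by (simp add: D1_def)
  have D1_eq: "ennreal D1 = ennreal (\<kappa> powr b) * ennreal ((2 * C) powr b * E)"
    unfolding D1_def using E by (intro ennreal_mult) auto
  show thesis
  proof (rule that[OF r0, of D])
    show "1 \<le> D" by (simp add: D_def)
    fix h f assume h: "0 < h" "h < r0" and [measurable]: "f \<in> borel_measurable lebesgue"
      and f1: "modular (\<lambda>x. f x * ennreal (v x)) \<le> 1"
    let ?c = "\<lambda>k. lattice_point h k :: 'a"
    let ?Q = "\<lambda>k. cube (?c k) (2 * h)"
    let ?V = "(4 * h) ^ ?n"
    let ?J = "\<lambda>k. \<integral>\<^sup>+ y\<in>?Q k. f y \<partial>lebesgue"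
    let ?g = "\<lambda>k x. enn_pow (?J k / ennreal ?V * ennreal (v x)) (p x) * indicator (?Q k) x"
    let ?\<alpha> = "\<lambda>k. \<integral>\<^sup>+ x. enn_pow (f x * ennreal (v x)) (p x) * indicator (?Q k) x \<partial>lebesgue"
    let ?T = "\<lambda>k. h ^ ?n / (exp 1 + norm (?c k)) ^ (?n + 1)"
    have V: "0 < ?V" using h by simp
    \<comment> \<open>The ball about x lies in the enlarged cube of one grid point near x, so a
      single term of the sum already dominates.\<close>
    have pw: "enn_pow (ball_average h f x * ennreal (v x)) (p x)
        \<le> (\<integral>\<^sup>+ k. ennreal (\<kappa> powr b) * ?g k x \<partial>count_space lattice_index)"
      if px: "a \<le> p x \<and> p x \<le> b" for x
    proof -
      obtain k where k: "k \<in> lattice_index" "x \<in> cube (?c k) h"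
        using lattice_cover[OF h(1)] by blast
      have sub: "ball x h \<subseteq> ?Q k"
        using ball_subset_cube[of x h] cube_trans[OF k(2), of _ h] by auto
      have xQ: "x \<in> ?Q k" using sub h by auto
      have "ball_average h f x \<le> ?J k / emeasure lebesgue (ball x h)"
        unfolding ball_average_def
        by (intro divide_right_mono_ennreal nn_integral_mono mult_left_mono)
           (use sub in \<open>auto simp: indicator_def\<close>)
      also have "\<dots> = ?J k / ennreal (?\<omega> * h ^ ?n)"
        using h by (subst emeasure_ball_lebesgue) auto
      also have "\<dots> = ennreal (4 ^ ?n / ?\<omega>) * (?J k / ennreal ?V)"
        using h content_unit_ball_pos[where 'a='a]
        by (simp add: divide_ennreal_real power_mult_distrib flip: mult.assoc ennreal_mult)
      also have "\<dots> \<le> ennreal \<kappa> * (?J k / ennreal ?V)"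
        by (intro mult_right_mono ennreal_leI) (auto simp: \<kappa>_def)
      finally have "ball_average h f x * ennreal (v x) \<le> ennreal \<kappa> * (?J k / ennreal ?V) * ennreal (v x)"
        by (intro mult_right_mono) auto
      then have "enn_pow (ball_average h f x * ennreal (v x)) (p x)
          \<le> enn_pow (ennreal \<kappa> * (?J k / ennreal ?V * ennreal (v x))) (p x)"
        using px a by (intro enn_pow_mono) (auto simp: mult.assoc)
      also have "\<dots> = ennreal (\<kappa> powr p x) * enn_pow (?J k / ennreal ?V * ennreal (v x)) (p x)"
        by (rule enn_pow_cmult) (simp add: \<kappa>_def)
      also have "\<dots> \<le> ennreal (\<kappa> powr b) * ?g k x"
        using px xQ by (auto intro!: mult_right_mono ennreal_leI powr_mono simp: \<kappa>_def)
      also have "\<dots> \<le> (\<integral>\<^sup>+ k. ennreal (\<kappa> powr b) * ?g k x \<partial>count_space lattice_index)"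
        using k(1) by (rule nn_integral_ge_point)
      finally show ?thesis .
    qed
    have cube_est: "(\<integral>\<^sup>+ x. ?g k x \<partial>lebesgue) \<le> ennreal ((2 * C) powr b * E) * (?\<alpha> k + ennreal (?T k))" for k
    proof -
      obtain l m where lm: "0 < l" "0 < m" "l * m \<le> C * ?V"
        "(\<integral>\<^sup>+ x. enn_pow (ennreal (v x * indicator (?Q k) x) / ennreal l) (p x) \<partial>lebesgue) \<le> 1"
        "(\<integral>\<^sup>+ x. enn_pow (ennreal (indicator (?Q k) x / v x) / ennreal m) (conj_exp p x) \<partial>lebesgue) \<le> 1"
        using CC[of "2 * h" "?c k"] h by auto
      obtain \<delta> where \<delta>: "0 \<le> \<delta>" "\<delta> \<le> 1 / 2" "\<And>x. x \<in> ?Q k \<Longrightarrow> \<bar>p x - p (?c k)\<bar> \<le> \<delta>"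
        "?T k \<le> 1" "?T k powr (- (2 * \<delta>)) \<le> E"
        using osc[OF h, of "?c k"] by blast
      define S where "S = p (?c k) + \<delta>"
      define s where "s = p (?c k) - \<delta>"
      have pS: "s \<le> p x \<and> p x \<le> S" if "x \<in> ?Q k" for x
        using \<delta>(3)[OF that] by (auto simp: S_def s_def)
      \<comment> \<open>The lower bound on p holds only almost everywhere and says nothing about p
        at the centre itself. But S < 1 would force p < 1 on the whole cube, which is not
        null.\<close>
      have S1: "1 \<le> S"
      proof (rule ccontr)
        assume S1: "\<not> 1 \<le> S"
        have "AE x in lebesgue. x \<notin> ?Q k"
          using AE_exponent by eventually_elim (use S1 pS a in force)
        with not_AE_not_mem_cube[of "2 * h" "?c k"] h show False by simp
      qed
      have "?\<alpha> k \<le> modular (\<lambda>x. f x * ennreal (v x))"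
        unfolding modular_def by (intro nn_integral_mono) (auto simp: indicator_def)
      then have "?\<alpha> k \<le> 1" using f1 by simp
      then obtain \<alpha> where \<alpha>: "0 \<le> \<alpha>" "\<alpha> \<le> 1" "?\<alpha> k = ennreal \<alpha>"
        by (cases "?\<alpha> k") (auto simp: top_unique)
      have "(\<integral>\<^sup>+ x. ?g k x \<partial>lebesgue) \<le> ennreal ((2 * C) powr b * \<alpha> powr (s / S))"
        by (rule cube_modular_estimate[OF a _ _ _ v0 v_pos lm(1-3) V C lm(4,5) _ pS \<alpha>])
           (use S1 in auto)
      also have "\<alpha> powr (s / S) \<le> E * (\<alpha> + ?T k)"
      proof -
        \<comment> \<open>The exponent loss is 2 \<delta> / S, at most 2 \<delta> because S >=
          1.\<close>
        have "s / S = 1 - 2 * \<delta> / S" using S1 by (simp add: s_def S_def field_simps)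
        moreover have "2 * \<delta> / S \<le> 2 * \<delta>" using divide_left_mono[of 1 S "2 * \<delta>"] S1 \<delta>(1) by simp
        ultimately show ?thesis
          using powr_one_minus_le[OF \<alpha>(1) _ \<delta>(4) _ _ _ \<delta>(5), of "2 * \<delta> / S"] S1 \<delta>(1,2) h
          by (simp add: add_pos_nonneg)
      qed
      finally have "(\<integral>\<^sup>+ x. ?g k x \<partial>lebesgue) \<le> ennreal ((2 * C) powr b * (E * (\<alpha> + ?T k)))"
        by (simp add: ennreal_leI mult_left_mono)
      also have "\<dots> = ennreal ((2 * C) powr b * E) * ennreal (\<alpha> + ?T k)"
        using \<alpha>(1) h by (subst ennreal_mult''[symmetric]) (auto simp: mult.assoc)
      also have "ennreal (\<alpha> + ?T k) = ennreal \<alpha> + ennreal (?T k)"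
        using \<alpha>(1) h by (intro ennreal_plus) auto
      finally show ?thesis by (simp add: \<alpha>)
    qed
    have sum_\<alpha>: "(\<integral>\<^sup>+ k. ?\<alpha> k \<partial>count_space lattice_index) \<le> ennreal (5 ^ ?n)"
    proof -
      have "(\<integral>\<^sup>+ k. ?\<alpha> k \<partial>count_space lattice_index)
          = (\<integral>\<^sup>+ x. \<integral>\<^sup>+ k. enn_pow (f x * ennreal (v x)) (p x) * indicator (?Q k) x \<partial>count_space lattice_index \<partial>lebesgue)"
        by (subst nn_integral_count_space_nn_integral) auto
      also have "\<dots> = (\<integral>\<^sup>+ x. enn_pow (f x * ennreal (v x)) (p x) *
          (\<integral>\<^sup>+ k. indicator (?Q k) x \<partial>count_space lattice_index) \<partial>lebesgue)"
        by (simp add: nn_integral_cmult)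
      also have "\<dots> \<le> (\<integral>\<^sup>+ x. enn_pow (f x * ennreal (v x)) (p x) * ennreal (5 ^ ?n) \<partial>lebesgue)"
        using h by (intro nn_integral_mono mult_left_mono lattice_overlap) auto
      also have "\<dots> = modular (\<lambda>x. f x * ennreal (v x)) * ennreal (5 ^ ?n)"
        unfolding modular_def by (rule nn_integral_multc) measurable
      also have "\<dots> \<le> 1 * ennreal (5 ^ ?n)" by (intro mult_right_mono f1) simp
      finally show ?thesis by simp
    qed
    \<comment> \<open>On the cube e + |x| is at most 2 (e + |c|), so T is at most the integral over
      the cube of a multiple of the decay function; bounded overlap then bounds the sum of T
      independently of h.\<close>
    have T_le: "ennreal (?T k) \<le> (\<integral>\<^sup>+ x. ennreal (2 ^ (?n + 1) * ?dec x) * indicator (?Q k) x \<partial>lebesgue)" for k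
    proof -
      have "ennreal (?T k) \<le> ennreal (?dec (?c k)) * ennreal ?V"
      proof (subst ennreal_mult[symmetric])
        have "h ^ ?n \<le> ?V" using h by (intro power_mono) auto
        then show "ennreal (?T k) \<le> ennreal (?dec (?c k) * ?V)"
          by (intro ennreal_leI) (simp add: divide_right_mono)
      qed (use h in auto)
      also have "\<dots> = (\<integral>\<^sup>+ x. ennreal (?dec (?c k)) * indicator (?Q k) x \<partial>lebesgue)"
        using h by (subst nn_integral_cmult_indicator, simp, subst emeasure_cube) auto
      also have "\<dots> \<le> (\<integral>\<^sup>+ x. ennreal (2 ^ (?n + 1) * ?dec x) * indicator (?Q k) x \<partial>lebesgue)"
      proof (rule nn_integral_mono)
        fix x
        show "ennreal (?dec (?c k)) * indicator (?Q k) x \<le> ennreal (2 ^ (?n + 1) * ?dec x) * indicator (?Q k) x"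
        proof (cases "x \<in> ?Q k")
          case True
          then have "norm (x - ?c k) \<le> 1" using osc[OF h, of "?c k"] by blast
          then have "norm x \<le> norm (?c k) + 1" using norm_triangle_ineq2[of x "?c k"] by linarith
          then have "exp 1 + norm x \<le> 2 * (exp 1 + norm (?c k))"
            using exp_ge_add_one_self[of "1::real"] norm_ge_zero[of "?c k"]
            unfolding distrib_left by linarith
          then have "(exp 1 + norm x) ^ (?n + 1) \<le> (2 * (exp 1 + norm (?c k))) ^ (?n + 1)"
            by (intro power_mono) auto
          also have "\<dots> = 2 ^ (?n + 1) * (exp 1 + norm (?c k)) ^ (?n + 1)"
            by (rule power_mult_distrib)
          finally have "?dec (?c k) \<le> 2 ^ (?n + 1) * ?dec x"
            by (simp add: divide_simps add_pos_nonneg del: power_Suc)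
          then show ?thesis by (intro mult_right_mono ennreal_leI) auto
        qed simp
      qed
      finally show ?thesis .
    qed
    have "(\<integral>\<^sup>+ k. ennreal (?T k) \<partial>count_space lattice_index)
        \<le> (\<integral>\<^sup>+ k. \<integral>\<^sup>+ x. ennreal (2 ^ (?n + 1) * ?dec x) * indicator (?Q k) x \<partial>lebesgue \<partial>count_space lattice_index)"
      by (rule nn_integral_mono) (rule T_le)
    also have "\<dots> = (\<integral>\<^sup>+ x. \<integral>\<^sup>+ k. ennreal (2 ^ (?n + 1) * ?dec x) * indicator (?Q k) x \<partial>count_space lattice_index \<partial>lebesgue)"
      by (rule nn_integral_count_space_nn_integral[symmetric]) (simp, measurable)
    also have "\<dots> = (\<integral>\<^sup>+ x. ennreal (2 ^ (?n + 1) * ?dec x) *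
        (\<integral>\<^sup>+ k. indicator (?Q k) x \<partial>count_space lattice_index) \<partial>lebesgue)"
      by (simp add: nn_integral_cmult)
    also have "\<dots> \<le> (\<integral>\<^sup>+ x. ennreal (2 ^ (?n + 1) * ?dec x) * ennreal (5 ^ ?n) \<partial>lebesgue)"
      using h by (intro nn_integral_mono mult_left_mono lattice_overlap) auto
    also have "\<dots> = (\<integral>\<^sup>+ x. ennreal (5 ^ ?n * 2 ^ (?n + 1)) * ennreal (?dec x) \<partial>lebesgue)"
      by (intro nn_integral_cong) (simp add: mult_ac flip: ennreal_mult)
    also have "\<dots> = ennreal (5 ^ ?n * 2 ^ (?n + 1)) * ennreal W"
      unfolding W(2)[symmetric] by (rule nn_integral_cmult) measurable
    also have "\<dots> = ennreal (5 ^ ?n * (2 ^ (?n + 1) * W))"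
      using W by (simp add: mult.assoc flip: ennreal_mult)
    finally have sum_T: "(\<integral>\<^sup>+ k. ennreal (?T k) \<partial>count_space lattice_index) \<le> ennreal (5 ^ ?n * (2 ^ (?n + 1) * W))" .
    have "modular (\<lambda>x. ball_average h f x * ennreal (v x))
        \<le> (\<integral>\<^sup>+ x. \<integral>\<^sup>+ k. ennreal (\<kappa> powr b) * ?g k x \<partial>count_space lattice_index \<partial>lebesgue)"
      unfolding modular_def
      by (rule nn_integral_mono_AE, use AE_exponent in eventually_elim) (use pw in blast)
    also have "\<dots> = (\<integral>\<^sup>+ k. \<integral>\<^sup>+ x. ennreal (\<kappa> powr b) * ?g k x \<partial>lebesgue \<partial>count_space lattice_index)"
      by (rule nn_integral_count_space_nn_integral) auto
    also have "\<dots> = (\<integral>\<^sup>+ k. ennreal (\<kappa> powr b) * (\<integral>\<^sup>+ x. ?g k x \<partial>lebesgue) \<partial>count_space lattice_index)"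
      by (intro nn_integral_cong nn_integral_cmult) measurable
    also have "\<dots> \<le> (\<integral>\<^sup>+ k. ennreal (\<kappa> powr b) * (ennreal ((2 * C) powr b * E) * (?\<alpha> k + ennreal (?T k))) \<partial>count_space lattice_index)"
      by (intro nn_integral_mono mult_left_mono cube_est) auto
    also have "\<dots> = (\<integral>\<^sup>+ k. ennreal D1 * (?\<alpha> k + ennreal (?T k)) \<partial>count_space lattice_index)"
      by (intro nn_integral_cong) (simp only: D1_eq mult.assoc)
    also have "\<dots> = ennreal D1 * ((\<integral>\<^sup>+ k. ?\<alpha> k \<partial>count_space lattice_index) + (\<integral>\<^sup>+ k. ennreal (?T k) \<partial>count_space lattice_index))"
      by (subst nn_integral_cmult, simp, subst nn_integral_add, simp_all)
    also have "\<dots> \<le> ennreal D1 * (ennreal (5 ^ ?n) + ennreal (5 ^ ?n * (2 ^ (?n + 1) * W)))"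
      by (intro mult_left_mono add_mono sum_\<alpha> sum_T) auto
    also have "\<dots> = ennreal (D1 * (5 ^ ?n + 5 ^ ?n * (2 ^ (?n + 1) * W)))"
      using D1 W(1) by (simp only: ennreal_plus[symmetric] ennreal_mult[symmetric] zero_le_power
          zero_le_numeral mult_nonneg_nonneg add_nonneg_nonneg)
    also have "\<dots> \<le> ennreal D" by (intro ennreal_leI) (simp add: D_def)
    finally show "modular (\<lambda>x. ball_average h f x * ennreal (v x)) \<le> ennreal D" .
  qed
qed

subsection \<open>Mean oscillation in weighted spaces\<close>

lemma ball_average_mono: "(\<And>y. y \<in> ball x r \<Longrightarrow> F y \<le> G y) \<Longrightarrow> ball_average r F x \<le> ball_average r G x"
  unfolding ball_average_def
  by (intro divide_right_mono_ennreal nn_integral_mono) (auto simp: indicator_def)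

lemma ball_average_cmult:
  assumes [measurable]: "F \<in> borel_measurable lebesgue"
  shows "ball_average r (\<lambda>y. c * F y) x = c * ball_average r F x"
  unfolding ball_average_def by (simp add: nn_integral_cmult mult.assoc ennreal_times_divide)

lemma ball_average_add:
  assumes [measurable]: "F \<in> borel_measurable lebesgue" "G \<in> borel_measurable lebesgue"
  shows "ball_average r (\<lambda>y. F y + G y) x = ball_average r F x + ball_average r G x"
  unfolding ball_average_def
  by (simp add: nn_integral_add distrib_right divide_ennreal_def)

lemma ball_average_const: "0 < r \<Longrightarrow> ball_average r (\<lambda>y. c) (x::'a::euclidean_space) = c"
proof -
  assume r: "0 < r"
  have *: "0 < measure lborel (ball (0::'a) 1) * r ^ DIM('a)"
    using r content_unit_ball_pos[where 'a='a] by simp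
  show ?thesis
    unfolding ball_average_def
    by (subst nn_integral_cmult_indicator, simp, subst (1 2) emeasure_ball_lebesgue[OF r],
        rule ennreal_mult_divide_eq) (use * r in auto)
qed

text \<open>A quasi-triangle inequality for q-means. The pointwise factor 2^q becomes 2 under the
  root, and splitting the root of a sum costs 2^(1/q).\<close>

lemma enn_pow_ball_average_le:
  assumes q: "0 < q" and [measurable]: "G \<in> borel_measurable lebesgue" "H \<in> borel_measurable lebesgue"
    and le: "\<And>y. y \<in> ball x r \<Longrightarrow> F y \<le> ennreal (2 powr q) * (G y + H y)"
  shows "enn_pow (ball_average r F x) (1 / q) \<le> ennreal (2 * 2 powr (1 / q)) *
    (enn_pow (ball_average r G x) (1 / q) + enn_pow (ball_average r H x) (1 / q))"
proof -
  have "ball_average r F x \<le> ball_average r (\<lambda>y. ennreal (2 powr q) * (G y + H y)) x"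
    by (rule ball_average_mono) (rule le)
  also have "\<dots> = ennreal (2 powr q) * (ball_average r G x + ball_average r H x)"
    by (simp add: ball_average_cmult ball_average_add)
  finally have "enn_pow (ball_average r F x) (1 / q)
      \<le> enn_pow (ennreal (2 powr q) * (ball_average r G x + ball_average r H x)) (1 / q)"
    using q by (intro enn_pow_mono) auto
  also have "\<dots> = ennreal 2 * enn_pow (ball_average r G x + ball_average r H x) (1 / q)"
    using q by (simp add: enn_pow_cmult powr_powr)
  also have "\<dots> \<le> ennreal 2 * (ennreal (2 powr (1 / q)) *
      (enn_pow (ball_average r G x) (1 / q) + enn_pow (ball_average r H x) (1 / q)))"
    using q by (intro mult_left_mono enn_pow_add_le) auto
  also have "\<dots> = ennreal (2 * 2 powr (1 / q)) * (enn_pow (ball_average r G x) (1 / q) + enn_pow (ball_average r H x) (1 / q))"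
    by (subst mult.assoc[symmetric], subst ennreal_mult''[symmetric]) auto
  finally show ?thesis .
qed

lemma abs_powr_add_le:
  fixes s t u q :: real
  assumes "0 < q" "\<bar>u\<bar> \<le> \<bar>s\<bar> + \<bar>t\<bar>"
  shows "ennreal (\<bar>u\<bar> powr q) \<le> ennreal (2 powr q) * (ennreal (\<bar>s\<bar> powr q) + ennreal (\<bar>t\<bar> powr q))"
proof -
  have "ennreal (\<bar>u\<bar> powr q) = enn_pow (ennreal \<bar>u\<bar>) q" by (simp add: enn_pow_ennreal)
  also have "\<dots> \<le> enn_pow (ennreal \<bar>s\<bar> + ennreal \<bar>t\<bar>) q"
    using assms by (intro enn_pow_mono) (auto simp flip: ennreal_plus)
  also have "\<dots> \<le> ennreal (2 powr q) * (enn_pow (ennreal \<bar>s\<bar>) q + enn_pow (ennreal \<bar>t\<bar>) q)"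
    using assms by (intro enn_pow_add_le)
  finally show ?thesis by (simp add: enn_pow_ennreal)
qed

lemma osc_eq_ball_average:
  "osc q r f x = enn_pow (ball_average r (\<lambda>y. ennreal (\<bar>f x - f y\<bar> powr q)) x) (1 / q)"
  by (simp only: osc_def ball_average_def)

lemma osc_add_le:
  assumes "0 < q" and [measurable]: "g \<in> borel_measurable lebesgue" "h \<in> borel_measurable lebesgue"
  shows "osc q r (\<lambda>x. g x + h x) x \<le> ennreal (2 * 2 powr (1 / q)) * (osc q r g x + osc q r h x)"
  unfolding osc_eq_ball_average using assms(1)
  by (intro enn_pow_ball_average_le abs_powr_add_le) auto

text \<open>Splitting f(x) - f(y) reduces bounds for the oscillation to bounds for averages of
  |f|^q; the average of the constant |f(x)|^q gives |f(x)| back.\<close>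

lemma osc_le_average:
  assumes "0 < q" "0 < r" and [measurable]: "f \<in> borel_measurable lebesgue"
  shows "osc q r f x \<le> ennreal (2 * 2 powr (1 / q)) *
    (ennreal \<bar>f x\<bar> + enn_pow (ball_average r (\<lambda>y. ennreal (\<bar>f y\<bar> powr q)) x) (1 / q))"
proof -
  have "osc q r f x \<le> ennreal (2 * 2 powr (1 / q)) *
    (enn_pow (ball_average r (\<lambda>y. ennreal (\<bar>f x\<bar> powr q)) x) (1 / q)
      + enn_pow (ball_average r (\<lambda>y. ennreal (\<bar>f y\<bar> powr q)) x) (1 / q))"
    unfolding osc_eq_ball_average using assms(1)
    by (intro enn_pow_ball_average_le abs_powr_add_le) auto
  also have "enn_pow (ball_average r (\<lambda>y. ennreal (\<bar>f x\<bar> powr q)) x) (1 / q) = ennreal \<bar>f x\<bar>"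
    using assms(1,2) by (simp add: ball_average_const enn_pow_ennreal powr_powr)
  finally show ?thesis .
qed

text \<open>In the inner integral g is replaced by a Borel function equal to it almost everywhere,
  which changes no value of the integral; the integrand is then jointly measurable and measurability
  of parameter integrals applies. The kernel \<open>k\<close> serves both the oscillation and the
  averages of |f|^q.\<close>

lemma ball_average_kernel_measurable:
  fixes k :: "real \<times> real \<Rightarrow> ennreal" and f g :: "'a::euclidean_space \<Rightarrow> real"
  assumes [measurable]: "k \<in> borel_measurable borel" 
    "f \<in> borel_measurable lebesgue" "g \<in> borel_measurable lebesgue" and r: "0 < r"
  shows "(\<lambda>x. ball_average r (\<lambda>y. k (f x, g y)) x) \<in> borel_measurable lebesgue"
proof -
  obtain g' where [measurable]: "g' \<in> borel_measurable lborel" and g': "AE y in lborel. g y = g' y"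
    using completion_ex_borel_measurable_real[OF assms(3)] by blast
  have [measurable]: "k \<in> borel_measurable (borel \<Otimes>\<^sub>M borel)"
    using assms(1) by (simp add: borel_prod)
  have [measurable]: "(\<lambda>x::'a. x) \<in> borel_measurable lebesgue"
    by (intro measurable_completion) auto
  have *: "(\<integral>\<^sup>+ y\<in>ball x r. k (f x, g y) \<partial>lebesgue)
      = (\<integral>\<^sup>+ y. k (f x, g' y) * (if dist x y < r then 1 else 0) \<partial>lborel)" for x
    unfolding nn_integral_completion
    by (rule nn_integral_cong_AE, use g' in eventually_elim) (auto simp: indicator_def)
  have [measurable]: "(\<lambda>x. \<integral>\<^sup>+ y. k (f x, g' y) * (if dist x y < r then 1 else 0) \<partial>lborel) \<in> borel_measurable lebesgue"
    by (rule lborel.borel_measurable_nn_integral) measurable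
  show ?thesis
    unfolding ball_average_def * emeasure_ball_lebesgue[OF r] by measurable
qed

lemma osc_measurable [measurable]:
  fixes f :: "'a::euclidean_space \<Rightarrow> real"
  assumes "f \<in> borel_measurable lebesgue" "0 < r"
  shows "osc q r f \<in> borel_measurable lebesgue"
proof -
  have *: "(\<lambda>(s::real, t::real). ennreal (\<bar>s - t\<bar> powr q)) \<in> borel_measurable borel"
    unfolding borel_prod[symmetric] by measurable
  have [measurable]: "(\<lambda>x. ball_average r (\<lambda>y. ennreal (\<bar>f x - f y\<bar> powr q)) x) \<in> borel_measurable lebesgue"
    using ball_average_kernel_measurable[OF * assms(1,1,2)] by simp
  show ?thesis
    unfolding osc_eq_ball_average[abs_def] by measurable
qed

lemma ball_average_powr_measurable:
  fixes f :: "'a::euclidean_space \<Rightarrow> real"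
  assumes "f \<in> borel_measurable lebesgue" "0 < r"
  shows "(\<lambda>x. ball_average r (\<lambda>y. ennreal (\<bar>f y\<bar> powr q)) x) \<in> borel_measurable lebesgue"
proof -
  have *: "(\<lambda>(s::real, t::real). ennreal (\<bar>t\<bar> powr q)) \<in> borel_measurable borel"
    unfolding borel_prod[symmetric] by measurable
  show ?thesis
    using ball_average_kernel_measurable[OF * assms(1,1,2)] by simp
qed

section \<open>The weighted quasinorm and the boundedness of the oscillation\<close>

locale weighted_space = bdd_exponent p a b
  for p :: "'a::euclidean_space \<Rightarrow> real" and a b :: real +
  fixes w :: "'a \<Rightarrow> real" and q :: real
  assumes q_pos: "0 < q" and q_less: "q < a"
    and weight: "is_weight w" and muckenhoupt: "A_var (\<lambda>x. p x / q) (\<lambda>x. w x powr q)"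
    and log_hoelder: "in_LH p"
begin

lemma w_measurable [measurable]: "w \<in> borel_measurable lebesgue"
  using weight by (simp add: is_weight_def)

lemma w_pos: "AE x in lebesgue. 0 < w x"
  using weight by (simp add: is_weight_def)

abbreviation N :: "('a \<Rightarrow> ennreal) \<Rightarrow> ennreal" where "N \<equiv> wnorm_enn p w"

lemma wnorm_eq: "wnorm p w f = N (\<lambda>x. ennreal \<bar>f x\<bar>)"
  by (simp add: wnorm_def wnorm_enn_def lux_norm_def abs_mult ennreal_mult)

lemma N_mono_AE: "AE x in lebesgue. g x \<le> h x \<Longrightarrow> N g \<le> N h"
  unfolding wnorm_enn_def
  by (rule lux_norm_mono_AE, erule eventually_mono) (auto intro: mult_right_mono)

lemma N_mono: "(\<And>x. g x \<le> h x) \<Longrightarrow> N g \<le> N h"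
  by (rule N_mono_AE) simp

lemma N_cmult_le: "0 < c \<Longrightarrow> N (\<lambda>x. ennreal c * g x) \<le> ennreal c * N g"
  unfolding wnorm_enn_def mult.assoc by (rule lux_norm_cmult_le)

lemma N_add_le:
  assumes [measurable]: "g \<in> borel_measurable lebesgue" "h \<in> borel_measurable lebesgue"
  shows "N (\<lambda>x. g x + h x) \<le> ennreal K * (N g + N h)"
  unfolding wnorm_enn_def distrib_right by (rule lux_norm_add_le) measurable

lemma N_eq_0_AE:
  assumes [measurable]: "g \<in> borel_measurable lebesgue" and "N g = 0"
  shows "AE x in lebesgue. g x = 0"
proof -
  have "AE x in lebesgue. g x * ennreal \<bar>w x\<bar> = 0"
    using assms(2) unfolding wnorm_enn_def by (rule lux_norm_eq_0_AE[rotated]) measurable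
  then show ?thesis using w_pos by eventually_elim auto
qed

lemma N_dominated_convergence:
  assumes [measurable]: "\<And>n. g n \<in> borel_measurable lebesgue" "G \<in> borel_measurable lebesgue"
    and fin: "N G < \<infinity>" and dom: "\<And>n. AE x in lebesgue. g n x \<le> G x"
    and lim: "AE x in lebesgue. (\<lambda>n. g n x) \<longlonglongrightarrow> 0" and e: "0 < e"
  shows "eventually (\<lambda>n. N (g n) \<le> ennreal e) sequentially"
  unfolding wnorm_enn_def
proof (rule lux_norm_dominated_convergence[where G = "\<lambda>x. G x * ennreal \<bar>w x\<bar>"])
  show "AE x in lebesgue. g n x * ennreal \<bar>w x\<bar> \<le> G x * ennreal \<bar>w x\<bar>" for n
    using dom[of n] by eventually_elim (simp add: mult_right_mono)
  show "AE x in lebesgue. (\<lambda>n. g n x * ennreal \<bar>w x\<bar>) \<longlonglongrightarrow> 0"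
    using lim
  proof eventually_elim
    case (elim x)
    have "(\<lambda>n. ennreal \<bar>w x\<bar> * g n x) \<longlonglongrightarrow> ennreal \<bar>w x\<bar> * 0"
      by (rule ennreal_tendsto_cmult[OF _ elim]) simp
    then show ?case by (simp add: mult.commute)
  qed
qed (use fin e in \<open>auto simp: wnorm_enn_def\<close>)

lemma exponent_quotient: "bdd_exponent (\<lambda>x. p x / q) (a / q) (b / q)"
  using q_pos a_pos a_le_b AE_exponent
  by unfold_locales (auto simp: divide_right_mono elim: eventually_mono)

text \<open>The bridge to the hypothesis on w^q: pointwise, the integrand for f and w with exponent
  p is the integrand for |f|^q and w^q with exponent p/q.\<close>

lemma enn_pow_weight:
  "0 < w x \<Longrightarrow> enn_pow (t * ennreal \<bar>w x\<bar>) (p x) = enn_pow (enn_pow t q * ennreal (w x powr q)) (p x / q)"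
  using q_pos by (simp add: enn_pow_mult enn_pow_enn_pow enn_pow_ennreal powr_powr)

text \<open>The Muckenhoupt condition itself provides a scale l for w^q on the cube; its root
  l^(1/q) is a scale for w.\<close>

lemma N_indicator_cube_finite: "0 < R \<Longrightarrow> N (indicator (cube z R)) < \<infinity>"
proof -
  assume R: "0 < R"
  have v_pos: "AE x in lebesgue. 0 < w x powr q"
    using w_pos by eventually_elim simp
  have vm: "(\<lambda>x. w x powr q) \<in> borel_measurable lebesgue" by measurable
  obtain l where l: "0 < l"
    "(\<integral>\<^sup>+ x. enn_pow (ennreal (w x powr q * indicator (cube z R) x) / ennreal l) (p x / q) \<partial>lebesgue) \<le> 1"
  proof (rule A_var_witness[OF muckenhoupt vm powr_ge_zero v_pos], goal_cases)
    case (1 C)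
    show thesis using 1(3)[OF R, of z] 1(1) by blast
  qed
  let ?l = "l powr (1 / q)"
  have "modular (\<lambda>x. indicator (cube z R) x * ennreal \<bar>w x\<bar> / ennreal ?l)
      \<le> (\<integral>\<^sup>+ x. enn_pow (ennreal (w x powr q * indicator (cube z R) x) / ennreal l) (p x / q) \<partial>lebesgue)"
    unfolding modular_def
  proof (rule nn_integral_mono_AE, use w_pos in eventually_elim)
    fix x assume w: "0 < w x"
    have "enn_pow (indicator (cube z R) x * ennreal \<bar>w x\<bar> / ennreal ?l) (p x)
        = enn_pow (enn_pow (indicator (cube z R) x / ennreal ?l) q * ennreal (w x powr q)) (p x / q)"
      using l w by (subst enn_pow_weight[symmetric]) (auto simp: divide_ennreal_real mult_ac)
    also have "enn_pow (indicator (cube z R) x / ennreal ?l) q * ennreal (w x powr q)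
        = ennreal (w x powr q * indicator (cube z R) x) / ennreal l"
      using l(1) q_pos by (cases "x \<in> cube z R")
        (auto simp: divide_ennreal_real enn_pow_ennreal powr_divide powr_powr)
    finally show "enn_pow (indicator (cube z R) x * ennreal \<bar>w x\<bar> / ennreal ?l) (p x)
        \<le> enn_pow (ennreal (w x powr q * indicator (cube z R) x) / ennreal l) (p x / q)" by simp
  qed
  with l have "N (indicator (cube z R)) \<le> ennreal ?l"
    unfolding wnorm_enn_def by (intro lux_norm_enn_le) auto
  then show ?thesis by (rule order.strict_trans1) simp
qed

lemma N_indicator_finite:
  assumes "bounded A"
  shows "N (indicator A) < \<infinity>"
proof -
  obtain R where R: "0 < R" "A \<subseteq> ball 0 R"
    using assms bounded_subset_ballD by blast
  have "N (indicator A) \<le> N (indicator (cube 0 R))"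
    using R(2) ball_subset_cube[of 0 R] by (intro N_mono) (auto simp: indicator_def)
  with N_indicator_cube_finite[OF R(1)] show ?thesis by (rule order.strict_trans1[rotated])
qed

text \<open>The averaging bound is available only for functions of modular at most 1. Scaling by any
  l above the norm of f turns it into an inequality between norms, with a constant uniform in all
  radii below \<open>r0\<close>.\<close>

lemma N_osc_le:
  obtains r0 D where "0 < r0" "0 < D"
    "\<And>r f. 0 < r \<Longrightarrow> r < r0 \<Longrightarrow> f \<in> borel_measurable lebesgue \<Longrightarrow> N (osc q r f) \<le> ennreal D * wnorm p w f"
proof -
  interpret s: bdd_exponent "\<lambda>x. p x / q" "a / q" "b / q" by (rule exponent_quotient)
  have LH: "in_LH (\<lambda>x. p x / q)"
  proof -
    obtain C0 Ci pinf where C: "0 < C0" "0 < Ci"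
      "\<And>x y. norm (x - y) < 1/2 \<Longrightarrow> \<bar>p x - p y\<bar> \<le> C0 / (- ln (norm (x - y)))"
      "\<And>x. \<bar>p x - pinf\<bar> \<le> Ci / ln (exp 1 + norm x)"
      using log_hoelder unfolding in_LH_def by blast
    show ?thesis
      unfolding in_LH_def
    proof (intro exI conjI allI impI)
      show "0 < C0 / q" "0 < Ci / q" using C q_pos by auto
      show "\<bar>p x / q - p y / q\<bar> \<le> C0 / q / (- ln (norm (x - y)))" if "norm (x - y) < 1/2" for x y
        using divide_right_mono[OF C(3)[OF that], of q] q_pos
        by (simp add: diff_divide_distrib[symmetric] mult.commute)
      show "\<bar>p x / q - pinf / q\<bar> \<le> Ci / q / ln (exp 1 + norm x)" for x
        using divide_right_mono[OF C(4)[of x], of q] q_pos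
        by (simp add: diff_divide_distrib[symmetric] mult.commute)
    qed
  qed
  have v_pos: "AE x in lebesgue. 0 < w x powr q"
    using w_pos by eventually_elim simp
  have aq: "1 < a / q" using q_pos q_less by simp
  obtain r0 D where r0: "0 < r0" and D: "1 \<le> D"
    and av: "\<And>r f. 0 < r \<Longrightarrow> r < r0 \<Longrightarrow> f \<in> borel_measurable lebesgue \<Longrightarrow>
      s.modular (\<lambda>x. f x * ennreal (w x powr q)) \<le> 1 \<Longrightarrow>
      s.modular (\<lambda>x. ball_average r f x * ennreal (w x powr q)) \<le> ennreal D"
    using s.averaging_modular_bound[OF aq muckenhoupt LH _ _ v_pos] by auto
  \<comment> \<open>A modular bound D >= 1 gives the norm bound D^(1/a). In \<open>D2\<close> the
    factor \<open>2 * 2 powr (1 / q)\<close> comes from splitting the oscillation and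
    \<open>K\<close> from the triangle inequality.\<close>
  define D1 where "D1 = D powr (1 / a)"
  define D2 where "D2 = 2 * 2 powr (1 / q) * (K * (1 + D1))"
  have D1: "0 < D1" using D by (simp add: D1_def)
  have D2: "0 < D2" using D1 K_pos by (simp add: D2_def)
  have "N (osc q r f) \<le> ennreal D2 * wnorm p w f"
    if r: "0 < r" "r < r0" and [measurable]: "f \<in> borel_measurable lebesgue" for r f
  proof -
    define M where "M x = enn_pow (ball_average r (\<lambda>y. ennreal (\<bar>f y\<bar> powr q)) x) (1 / q)" for x
    have avm [measurable]: "(\<lambda>x. ball_average r (\<lambda>y. ennreal (\<bar>f y\<bar> powr q)) x) \<in> borel_measurable lebesgue"
      by (rule ball_average_powr_measurable) (use r in auto)
    have [measurable]: "M \<in> borel_measurable lebesgue"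
      unfolding M_def[abs_def] by measurable
    have NM: "N M \<le> ennreal D1 * wnorm p w f"
    proof (rule ennreal_le_cmult_of_less[OF D1])
      fix l assume l: "0 < l" "wnorm p w f < ennreal l"
      \<comment> \<open>This is (|f| / l)^q, written as a product so that the scale can be pulled
        out of averages; its modular with exponent p/q and weight w^q is that of f w / l, at most
        1.\<close>
      define f1 where "f1 x = ennreal ((1 / l) powr q) * ennreal (\<bar>f x\<bar> powr q)" for x
      have [measurable]: "f1 \<in> borel_measurable lebesgue" unfolding f1_def[abs_def] by measurable
      have f1: "f1 x = enn_pow (ennreal \<bar>f x\<bar> / ennreal l) q" for x
        using l by (simp add: f1_def divide_ennreal_real enn_pow_cmult enn_pow_ennreal)
      have "s.modular (\<lambda>x. f1 x * ennreal (w x powr q)) = modular (\<lambda>x. ennreal \<bar>f x\<bar> * ennreal \<bar>w x\<bar> / ennreal l)"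
        unfolding s.modular_def modular_def
      proof (rule nn_integral_cong_AE, use w_pos in eventually_elim)
        fix x assume "0 < w x"
        then have "enn_pow (f1 x * ennreal (w x powr q)) (p x / q) = enn_pow (ennreal \<bar>f x\<bar> / ennreal l * ennreal \<bar>w x\<bar>) (p x)"
          unfolding f1 by (rule enn_pow_weight[symmetric])
        then show "enn_pow (f1 x * ennreal (w x powr q)) (p x / q) = enn_pow (ennreal \<bar>f x\<bar> * ennreal \<bar>w x\<bar> / ennreal l) (p x)"
          using l by (simp add: divide_ennreal_real mult.assoc)
      qed
      also have "\<dots> \<le> 1"
        using l(2) unfolding wnorm_eq wnorm_enn_def by (rule modular_le_one)
      finally have "s.modular (\<lambda>x. ball_average r f1 x * ennreal (w x powr q)) \<le> ennreal D"
        using r by (intro av) auto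
      also have "s.modular (\<lambda>x. ball_average r f1 x * ennreal (w x powr q))
          = modular (\<lambda>x. ennreal (1 / l) * (M x * ennreal \<bar>w x\<bar>))"
        unfolding s.modular_def modular_def
      proof (rule nn_integral_cong_AE, use w_pos in eventually_elim)
        fix x assume w: "0 < w x"
        have "ball_average r f1 x = ennreal ((1 / l) powr q) * ball_average r (\<lambda>y. ennreal (\<bar>f y\<bar> powr q)) x"
          unfolding f1_def[abs_def] by (rule ball_average_cmult) measurable
        also have "\<dots> = enn_pow (ennreal (1 / l) * M x) q"
          using l q_pos by (simp add: M_def enn_pow_cmult enn_pow_enn_pow)
        finally show "enn_pow (ball_average r f1 x * ennreal (w x powr q)) (p x / q)
            = enn_pow (ennreal (1 / l) * (M x * ennreal \<bar>w x\<bar>)) (p x)"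
          using enn_pow_weight[OF w, of "ennreal (1 / l) * M x"] by (simp add: mult.assoc)
      qed
      finally have "lux_norm_enn p (\<lambda>x. ennreal (1 / l) * (M x * ennreal \<bar>w x\<bar>)) \<le> ennreal D1"
        unfolding D1_def by (intro lux_norm_le_of_modular_le D) measurable
      then have "ennreal l * lux_norm_enn p (\<lambda>x. ennreal (1 / l) * (M x * ennreal \<bar>w x\<bar>)) \<le> ennreal l * ennreal D1"
        by (intro mult_left_mono) auto
      moreover have "lux_norm_enn p (\<lambda>x. ennreal l * (ennreal (1 / l) * (M x * ennreal \<bar>w x\<bar>)))
          \<le> ennreal l * lux_norm_enn p (\<lambda>x. ennreal (1 / l) * (M x * ennreal \<bar>w x\<bar>))"
        by (rule lux_norm_cmult_le[OF l(1)])
      moreover have "(\<lambda>x. ennreal l * (ennreal (1 / l) * (M x * ennreal \<bar>w x\<bar>))) = (\<lambda>x. M x * ennreal \<bar>w x\<bar>)"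
        using l by (simp flip: mult.assoc ennreal_mult)
      ultimately show "N M \<le> ennreal (D1 * l)"
        using l D1 by (simp add: wnorm_enn_def ennreal_mult mult.commute)
    qed
    have "N (osc q r f) \<le> N (\<lambda>x. ennreal (2 * 2 powr (1 / q)) * (ennreal \<bar>f x\<bar> + M x))"
      unfolding M_def using r q_pos by (intro N_mono osc_le_average) auto
    also have "\<dots> \<le> ennreal (2 * 2 powr (1 / q)) * N (\<lambda>x. ennreal \<bar>f x\<bar> + M x)"
      by (rule N_cmult_le) simp
    also have "\<dots> \<le> ennreal (2 * 2 powr (1 / q)) * (ennreal K * (wnorm p w f + N M))"
      unfolding wnorm_eq by (intro mult_left_mono N_add_le) auto
    also have "\<dots> \<le> ennreal (2 * 2 powr (1 / q)) * (ennreal K * (wnorm p w f + ennreal D1 * wnorm p w f))"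
      by (intro mult_left_mono add_mono NM) auto
    also have "wnorm p w f + ennreal D1 * wnorm p w f = ennreal (1 + D1) * wnorm p w f"
      using D1 by (simp add: distrib_right)
    also have "ennreal (2 * 2 powr (1 / q)) * (ennreal K * (ennreal (1 + D1) * wnorm p w f)) = ennreal D2 * wnorm p w f"
      unfolding D2_def using D1 K_pos by (simp add: mult.assoc ennreal_mult'' del: ennreal_plus)
    finally show ?thesis .
  qed
  with r0 D2 that show thesis by blast
qed

end

subsection \<open>Total boundedness\<close>

lemma ennreal_tendsto_0_iff:
  fixes S :: "'b \<Rightarrow> ennreal"
  shows "(S \<longlongrightarrow> 0) F \<longleftrightarrow> (\<forall>e>0. eventually (\<lambda>x. S x \<le> ennreal e) F)"
proof (intro iffI allI impI)
  fix e :: real assume "(S \<longlongrightarrow> 0) F" "0 < e"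
  then have "eventually (\<lambda>x. S x < ennreal e) F" by (intro order_tendstoD(2)) auto
  then show "eventually (\<lambda>x. S x \<le> ennreal e) F" by (rule eventually_mono) simp
next
  assume *: "\<forall>e>0. eventually (\<lambda>x. S x \<le> ennreal e) F"
  show "(S \<longlongrightarrow> 0) F"
  proof (rule order_tendstoI)
    fix y :: ennreal assume "0 < y"
    then obtain e where e: "0 < e" "ennreal e < y"
    proof (cases y)
      case (real t)
      then show thesis using that[of "t / 2"] \<open>0 < y\<close> by (auto simp: ennreal_less_iff)
    next
      case top
      then show thesis using that[of 1] by simp
    qed
    with * have "eventually (\<lambda>x. S x \<le> ennreal e) F" by blast
    then show "eventually (\<lambda>x. S x < y) F" by (rule eventually_mono) (use e in auto)
  qed simp
qed

section \<open>Approximation by continuous functions of compact support\<close>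

context weighted_space
begin

lemma wnorm_triangle:
  assumes [measurable]: "f \<in> borel_measurable lebesgue" "g \<in> borel_measurable lebesgue" "h \<in> borel_measurable lebesgue"
  shows "wnorm p w (\<lambda>x. f x - h x) \<le> ennreal K * (wnorm p w (\<lambda>x. f x - g x) + wnorm p w (\<lambda>x. g x - h x))"
proof -
  have "wnorm p w (\<lambda>x. f x - h x) \<le> N (\<lambda>x. ennreal \<bar>f x - g x\<bar> + ennreal \<bar>g x - h x\<bar>)"
    unfolding wnorm_eq by (intro N_mono) (auto simp flip: ennreal_plus)
  also have "\<dots> \<le> ennreal K * (wnorm p w (\<lambda>x. f x - g x) + wnorm p w (\<lambda>x. g x - h x))"
    unfolding wnorm_eq by (rule N_add_le) measurable
  finally show ?thesis .
qed

lemma LpwD: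
  assumes "f \<in> Lpw p w"
  shows "f \<in> borel_measurable lebesgue" "wnorm p w f < \<infinity>"
  using assms by (auto simp: Lpw_def)

text \<open>Measurability yields continuous \<open>g n\<close> converging to f almost everywhere,
  but no dominating function. Both f and \<open>g n\<close> are therefore truncated in value and in
  space: |f| dominates the error of truncating f, and 2 m times the indicator of a ball, which has
  finite norm, dominates the rest.\<close>

lemma continuous_approximation:
  assumes f: "f \<in> Lpw p w" and e: "0 < e"
  obtains h R where "continuous_on UNIV h" "\<And>x. R < norm x \<Longrightarrow> h x = 0"
    "wnorm p w (\<lambda>x. f x - h x) \<le> ennreal e"
proof -
  note [measurable] = LpwD(1)[OF f]
  have [measurable]: "(\<lambda>x::'a. x) \<in> borel_measurable lebesgue"
    by (intro measurable_completion) auto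
  obtain Z g where Z: "negligible Z" and g: "\<And>n. continuous_on UNIV (g n)"
    and lim: "\<And>x. x \<notin> Z \<Longrightarrow> (\<lambda>n. g n x) \<longlonglongrightarrow> f x"
    using lebesgue_measurable_imp_measurable_on_real[OF LpwD(1)[OF f], of UNIV]
    unfolding measurable_on_def by auto
  have g_meas [measurable]: "g n \<in> borel_measurable lebesgue" for n
    using borel_measurable_continuous_onI[OF g] by (intro measurable_completion) simp
  define clamp where "clamp (m::real) t = max (- m) (min m t)" for m t :: real
  \<comment> \<open>A continuous cutoff, 1 for |x| <= m and 0 for |x| >= m + 1, so that truncating a
    continuous function keeps it continuous.\<close>
  define \<phi> where "\<phi> m x = max 0 (min 1 (m + 1 - norm x))" for m and x :: 'a
  have \<phi>: "0 \<le> \<phi> m x" "\<phi> m x \<le> 1" for m x by (auto simp: \<phi>_def)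
  define cut where "cut m F x = \<phi> m x * clamp m (F x)" for m F and x :: 'a
  have cut_meas [measurable]: "cut m F \<in> borel_measurable lebesgue" 
    if [measurable]: "F \<in> borel_measurable lebesgue" for m F
    unfolding cut_def[abs_def] clamp_def \<phi>_def by measurable
  define d where "d = e / (2 * K)"
  have d: "0 < d" using e K_pos by (simp add: d_def)
  have "eventually (\<lambda>m. N (\<lambda>x. ennreal \<bar>f x - cut (real m) f x\<bar>) \<le> ennreal d) sequentially"
  proof (rule N_dominated_convergence[where G = "\<lambda>x. ennreal \<bar>f x\<bar>"])
    show "N (\<lambda>x. ennreal \<bar>f x\<bar>) < \<infinity>" using LpwD(2)[OF f] by (simp add: wnorm_eq)
    show "AE x in lebesgue. ennreal \<bar>f x - cut (real m) f x\<bar> \<le> ennreal \<bar>f x\<bar>" for m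
    proof (intro AE_I2 ennreal_leI)
      fix x
      show "\<bar>f x - cut (real m) f x\<bar> \<le> \<bar>f x\<bar>"
      proof (cases "0 \<le> f x")
        case True
        then have "0 \<le> clamp (real m) (f x)" "clamp (real m) (f x) \<le> f x" by (auto simp: clamp_def)
        then have "0 \<le> cut (real m) f x" "cut (real m) f x \<le> 1 * f x"
          unfolding cut_def using \<phi>[of m x] by (intro mult_nonneg_nonneg mult_mono; simp)+
        then show ?thesis using True by simp
      next
        case False
        then have cl: "clamp (real m) (f x) \<le> 0" "f x \<le> clamp (real m) (f x)" by (auto simp: clamp_def)
        have "cut (real m) f x \<le> 0"
          unfolding cut_def using \<phi>[of m x] cl by (intro mult_nonneg_nonpos) auto
        moreover have "1 * clamp (real m) (f x) \<le> cut (real m) f x"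
          unfolding cut_def using \<phi>[of m x] cl by (intro mult_right_mono_neg) auto
        ultimately show ?thesis using False cl by simp
      qed
    qed
    show "AE x in lebesgue. (\<lambda>m. ennreal \<bar>f x - cut (real m) f x\<bar>) \<longlonglongrightarrow> 0"
    proof (rule AE_I2)
      fix x
      obtain M :: nat where "max (norm x) \<bar>f x\<bar> \<le> real M" using real_arch_simple by blast
      then have M: "norm x \<le> real M" "\<bar>f x\<bar> \<le> real M" by auto
      have "eventually (\<lambda>m. ennreal \<bar>f x - cut (real m) f x\<bar> = 0) sequentially"
        using eventually_ge_at_top[of M]
      proof eventually_elim
        case (elim m)
        then have "real M \<le> real m" by simp
        with M have "cut (real m) f x = f x"
          by (auto simp: cut_def \<phi>_def clamp_def max_def min_def)
        then show ?case by simp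
      qed
      then show "(\<lambda>m. ennreal \<bar>f x - cut (real m) f x\<bar>) \<longlonglongrightarrow> 0"
        by (rule tendsto_eventually)
    qed
  qed (use d in auto)
  \<comment> \<open>m >= 1 keeps the factor 2 m positive, as \<open>N_cmult_le\<close>
    requires.\<close>
  then have "eventually (\<lambda>m. N (\<lambda>x. ennreal \<bar>f x - cut (real m) f x\<bar>) \<le> ennreal d \<and> 1 \<le> m) sequentially"
    using eventually_ge_at_top[of "1::nat"] by (rule eventually_conj)
  then obtain m :: nat where m: "N (\<lambda>x. ennreal \<bar>f x - cut (real m) f x\<bar>) \<le> ennreal d" "1 \<le> m"
    using eventually_happens'[OF sequentially_bot] by blast
  let ?m = "real m"
  have [measurable]: "cball (0::'a) (?m + 1) \<in> sets lebesgue" by simp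
  have "eventually (\<lambda>n. N (\<lambda>x. ennreal \<bar>cut ?m f x - cut ?m (g n) x\<bar>) \<le> ennreal d) sequentially"
  proof (rule N_dominated_convergence[where G = "\<lambda>x. ennreal (2 * ?m) * indicator (cball 0 (?m + 1)) x"])
    have "N (\<lambda>x. ennreal (2 * ?m) * indicator (cball 0 (?m + 1)) x) \<le> ennreal (2 * ?m) * N (indicator (cball 0 (?m + 1)))"
      using m by (intro N_cmult_le) auto
    also have "\<dots> < \<infinity>"
      using N_indicator_finite[OF bounded_cball, of 0 "?m + 1"] by (simp add: ennreal_mult_less_top)
    finally show "N (\<lambda>x. ennreal (2 * ?m) * indicator (cball 0 (?m + 1)) x) < \<infinity>" .
    have cl: "\<bar>clamp ?m s - clamp ?m t\<bar> \<le> 2 * ?m" for s t by (auto simp: clamp_def)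
    show "AE x in lebesgue. ennreal \<bar>cut ?m f x - cut ?m (g n) x\<bar> \<le> ennreal (2 * ?m) * indicator (cball 0 (?m + 1)) x" for n
    proof (rule AE_I2)
      fix x
      show "ennreal \<bar>cut ?m f x - cut ?m (g n) x\<bar> \<le> ennreal (2 * ?m) * indicator (cball 0 (?m + 1)) x"
      proof (cases "norm x \<le> ?m + 1")
        case True
        have "\<bar>cut ?m f x - cut ?m (g n) x\<bar> = \<phi> ?m x * \<bar>clamp ?m (f x) - clamp ?m (g n x)\<bar>"
          using \<phi>[of ?m x] by (simp add: cut_def abs_mult flip: right_diff_distrib)
        also have "\<dots> \<le> 1 * (2 * ?m)" using \<phi>[of ?m x] by (intro mult_mono cl) auto
        finally show ?thesis using True by (simp add: ennreal_leI)
      next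
        case False
        then have "\<phi> ?m x = 0" by (simp add: \<phi>_def)
        then show ?thesis by (simp add: cut_def)
      qed
    qed
    have "AE x in lebesgue. x \<notin> Z"
      using Z by (intro AE_not_in) (simp add: negligible_iff_null_sets)
    then show "AE x in lebesgue. (\<lambda>n. ennreal \<bar>cut ?m f x - cut ?m (g n) x\<bar>) \<longlonglongrightarrow> 0"
    proof eventually_elim
      case (elim x)
      have "(\<lambda>n. \<bar>cut ?m f x - cut ?m (g n) x\<bar>) \<longlonglongrightarrow> \<bar>cut ?m f x - cut ?m f x\<bar>"
        unfolding cut_def clamp_def by (intro tendsto_intros lim elim)
      then show ?case by (intro tendsto_eq_rhs[OF tendsto_ennrealI]) auto
    qed
  qed (use d in auto)
  then obtain n where n: "N (\<lambda>x. ennreal \<bar>cut ?m f x - cut ?m (g n) x\<bar>) \<le> ennreal d"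
    using eventually_happens'[OF sequentially_bot] by blast
  show thesis
  proof (rule that[of "cut ?m (g n)" "?m + 1"])
    show "continuous_on UNIV (cut ?m (g n))"
      unfolding cut_def[abs_def] clamp_def \<phi>_def
      by (intro continuous_intros g)
    show "cut ?m (g n) x = 0" if "?m + 1 < norm x" for x
      using that by (simp add: cut_def \<phi>_def)
    have "wnorm p w (\<lambda>x. f x - cut ?m (g n) x)
        \<le> ennreal K * (wnorm p w (\<lambda>x. f x - cut ?m f x) + wnorm p w (\<lambda>x. cut ?m f x - cut ?m (g n) x))"
      by (rule wnorm_triangle) measurable
    also have "\<dots> \<le> ennreal K * (ennreal d + ennreal d)"
      using m n unfolding wnorm_eq by (intro mult_left_mono add_mono) auto
    also have "\<dots> = ennreal e"
      using d K_pos by (simp add: d_def field_simps flip: ennreal_plus ennreal_mult)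
    finally show "wnorm p w (\<lambda>x. f x - cut ?m (g n) x) \<le> ennreal e" .
  qed
qed

text \<open>For radii below 1 the oscillation of h vanishes where |x| > R + 1, and on the ball of
  radius R + 1 it compares values inside the ball of radius R + 2, on which h is uniformly
  continuous.\<close>

lemma N_osc_continuous:
  assumes h: "continuous_on UNIV h" "\<And>x. R < norm x \<Longrightarrow> h x = 0" and e: "0 < e"
  shows "eventually (\<lambda>r. N (osc q r h) \<le> ennreal e) (at_right 0)"
proof -
  obtain A where A: "0 \<le> A" "N (indicator (cball 0 (R + 1))) = ennreal A"
    using N_indicator_finite[OF bounded_cball, of 0 "R + 1"]
    by (cases "N (indicator (cball 0 (R + 1)))") auto
  \<comment> \<open>Adding 1 avoids division by A = 0 and still gives \<eta> A <= e.\<close>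
  define \<eta> where "\<eta> = e / (A + 1)"
  have \<eta>: "0 < \<eta>" using e A by (simp add: \<eta>_def)
  have "uniformly_continuous_on (cball 0 (R + 2)) h"
    using h(1) by (intro compact_uniformly_continuous) (auto intro: continuous_on_subset)
  then obtain d where d: "0 < d"
    "\<And>x y. x \<in> cball 0 (R + 2) \<Longrightarrow> y \<in> cball 0 (R + 2) \<Longrightarrow> dist y x < d \<Longrightarrow> dist (h y) (h x) < \<eta>"
    unfolding uniformly_continuous_on_def using \<eta> by metis
  have "N (osc q r h) \<le> ennreal e" if r: "r \<in> {0<..<min d 1}" for r
  proof -
    have "osc q r h x \<le> ennreal \<eta> * indicator (cball 0 (R + 1)) x" for x
    proof (cases "norm x \<le> R + 1")
      case True
      have "ball_average r (\<lambda>y. ennreal (\<bar>h x - h y\<bar> powr q)) x \<le> ball_average r (\<lambda>y. ennreal (\<eta> powr q)) x"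
      proof (rule ball_average_mono)
        fix y assume y: "y \<in> ball x r"
        have "norm y \<le> norm x + dist x y"
          using norm_triangle_ineq2[of y x] by (simp add: dist_norm norm_minus_commute)
        then have "norm y \<le> R + 2" using y True r by simp
        then have "dist (h x) (h y) < \<eta>"
          using True y r by (intro d) (auto simp: dist_commute)
        then show "ennreal (\<bar>h x - h y\<bar> powr q) \<le> ennreal (\<eta> powr q)"
          using q_pos by (intro ennreal_leI powr_mono2) (auto simp: dist_real_def)
      qed
      also have "\<dots> = ennreal (\<eta> powr q)" using r by (simp add: ball_average_const)
      finally have "osc q r h x \<le> enn_pow (ennreal (\<eta> powr q)) (1 / q)"
        unfolding osc_eq_ball_average using q_pos by (intro enn_pow_mono) auto
      also have "\<dots> = ennreal \<eta>" using q_pos \<eta> by (simp add: enn_pow_ennreal powr_powr)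
      finally show ?thesis using True by simp
    next
      case False
      have "ball_average r (\<lambda>y. ennreal (\<bar>h x - h y\<bar> powr q)) x \<le> ball_average r (\<lambda>y. 0) x"
      proof (rule ball_average_mono)
        fix y assume y: "y \<in> ball x r"
        have "norm x \<le> norm y + dist x y"
          using norm_triangle_ineq2[of x y] by (simp add: dist_norm)
        then have "R < norm y" "R < norm x" using y False r by auto
        then show "ennreal (\<bar>h x - h y\<bar> powr q) \<le> 0" by (simp add: h(2))
      qed
      also have "\<dots> = 0" using r by (simp add: ball_average_const)
      finally show ?thesis by (simp add: osc_eq_ball_average)
    qed
    then have "N (osc q r h) \<le> N (\<lambda>x. ennreal \<eta> * indicator (cball 0 (R + 1)) x)"
      by (rule N_mono)
    also have "\<dots> \<le> ennreal \<eta> * ennreal A"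
      unfolding A(2)[symmetric] by (rule N_cmult_le[OF \<eta>])
    also have "\<dots> \<le> ennreal e"
      using A e by (simp add: \<eta>_def field_simps flip: ennreal_mult)
    finally show ?thesis .
  qed
  then show ?thesis
    using eventually_at_right_real[of 0 "min d 1"] d(1) by (auto elim: eventually_mono)
qed

text \<open>Dominated convergence works along integer radii; the tails decrease in R, so one integer
  radius settles all larger ones.\<close>

lemma wnorm_tail:
  assumes g: "g \<in> Lpw p w" and e: "0 < e"
  shows "eventually (\<lambda>R. wnorm p w (\<lambda>x. g x * indicator (- ball x0 R) x) \<le> ennreal e) at_top"
proof -
  note [measurable] = LpwD(1)[OF g]
  have "eventually (\<lambda>n. N (\<lambda>x. ennreal \<bar>g x * indicator (- ball x0 (real n)) x\<bar>) \<le> ennreal e) sequentially"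
  proof (rule N_dominated_convergence[where G = "\<lambda>x. ennreal \<bar>g x\<bar>"])
    show "N (\<lambda>x. ennreal \<bar>g x\<bar>) < \<infinity>" using LpwD(2)[OF g] by (simp add: wnorm_eq)
    show "AE x in lebesgue. ennreal \<bar>g x * indicator (- ball x0 (real n)) x\<bar> \<le> ennreal \<bar>g x\<bar>" for n
      by (intro AE_I2 ennreal_leI) (auto simp: indicator_def)
    show "AE x in lebesgue. (\<lambda>n. ennreal \<bar>g x * indicator (- ball x0 (real n)) x\<bar>) \<longlonglongrightarrow> 0"
    proof (rule AE_I2)
      fix x
      obtain M :: nat where M: "dist x0 x < real M" using reals_Archimedean2 by blast
      have "eventually (\<lambda>n. ennreal \<bar>g x * indicator (- ball x0 (real n)) x\<bar> = 0) sequentially"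
        using eventually_ge_at_top[of M]
      proof eventually_elim
        case (elim n)
        then have "real M \<le> real n" by simp
        with M have "x \<in> ball x0 (real n)" by simp
        then show ?case by simp
      qed
      then show "(\<lambda>n. ennreal \<bar>g x * indicator (- ball x0 (real n)) x\<bar>) \<longlonglongrightarrow> 0"
        by (rule tendsto_eventually)
    qed
  qed (use e in auto)
  then obtain n where n: "N (\<lambda>x. ennreal \<bar>g x * indicator (- ball x0 (real n)) x\<bar>) \<le> ennreal e"
    using eventually_happens'[OF sequentially_bot] by blast
  have "wnorm p w (\<lambda>x. g x * indicator (- ball x0 R) x) \<le> ennreal e" if "real n \<le> R" for R
    unfolding wnorm_eq
    by (rule order_trans[OF N_mono n]) (use that in \<open>auto simp: indicator_def\<close>)
  then show ?thesis by (auto simp: eventually_at_top_linorder)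
qed

section \<open>Necessity of the three conditions\<close>

context
  fixes F :: "('a \<Rightarrow> real) set" and x0 :: 'a
  assumes F: "F \<subseteq> Lpw p w" and tb: "totally_bounded_Lpw p w F"
begin

lemma finite_net:
  assumes "0 < e"
  obtains G where "finite G" "G \<subseteq> Lpw p w" "\<And>f. f \<in> F \<Longrightarrow> \<exists>g\<in>G. wnorm p w (\<lambda>x. f x - g x) \<le> ennreal e"
  using tb assms less_imp_le unfolding totally_bounded_Lpw_def by metis

lemma totally_bounded_imp_bounded: "(SUP f\<in>F. wnorm p w f) < \<infinity>"
proof -
  obtain G where G: "finite G" "G \<subseteq> Lpw p w" "\<And>f. f \<in> F \<Longrightarrow> \<exists>g\<in>G. wnorm p w (\<lambda>x. f x - g x) \<le> ennreal 1"
    using finite_net[of 1] by auto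
  have "(SUP f\<in>F. wnorm p w f) \<le> ennreal K * (ennreal 1 + (\<Sum>g\<in>G. wnorm p w g))"
  proof (rule SUP_least)
    fix f assume "f \<in> F"
    then obtain g where g: "g \<in> G" "wnorm p w (\<lambda>x. f x - g x) \<le> ennreal 1" using G by blast
    have "wnorm p w (\<lambda>x. f x - 0) \<le> ennreal K * (wnorm p w (\<lambda>x. f x - g x) + wnorm p w (\<lambda>x. g x - 0))"
      using \<open>f \<in> F\<close> F g(1) G(2) by (intro wnorm_triangle) (auto simp: Lpw_def)
    also have "\<dots> \<le> ennreal K * (ennreal 1 + (\<Sum>g\<in>G. wnorm p w g))"
      using g G(1) by (intro mult_left_mono add_mono) (auto intro!: member_le_sum)
    finally show "wnorm p w f \<le> ennreal K * (ennreal 1 + (\<Sum>g\<in>G. wnorm p w g))" by simp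
  qed
  also have "\<dots> < \<infinity>"
    using G(1,2) LpwD(2) by (auto simp: ennreal_mult_less_top subset_iff)
  finally show ?thesis .
qed

lemma totally_bounded_imp_tails:
  "((\<lambda>R. SUP f\<in>F. wnorm p w (\<lambda>x. f x * indicator (- ball x0 R) x)) \<longlongrightarrow> 0) at_top"
  unfolding ennreal_tendsto_0_iff
proof (intro allI impI)
  fix e :: real assume e: "0 < e"
  define d where "d = e / (2 * K)"
  have d: "0 < d" using e K_pos by (simp add: d_def)
  obtain G where G: "finite G" "G \<subseteq> Lpw p w" "\<And>f. f \<in> F \<Longrightarrow> \<exists>g\<in>G. wnorm p w (\<lambda>x. f x - g x) \<le> ennreal d"
    using finite_net[OF d] by blast
  have "eventually (\<lambda>R. \<forall>g\<in>G. wnorm p w (\<lambda>x. g x * indicator (- ball x0 R) x) \<le> ennreal d) at_top"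
    using G wnorm_tail d by (intro eventually_ball_finite) auto
  then show "eventually (\<lambda>R. (SUP f\<in>F. wnorm p w (\<lambda>x. f x * indicator (- ball x0 R) x)) \<le> ennreal e) at_top"
  proof eventually_elim
    case (elim R)
    show ?case
    proof (rule SUP_least)
      fix f assume "f \<in> F"
      then obtain g where g: "g \<in> G" "wnorm p w (\<lambda>x. f x - g x) \<le> ennreal d" using G by blast
      have [measurable]: "f \<in> borel_measurable lebesgue" "g \<in> borel_measurable lebesgue"
        using \<open>f \<in> F\<close> F g(1) G(2) by (auto simp: Lpw_def)
      have "wnorm p w (\<lambda>x. f x * indicator (- ball x0 R) x)
          \<le> N (\<lambda>x. ennreal \<bar>f x - g x\<bar> + ennreal \<bar>g x * indicator (- ball x0 R) x\<bar>)"
        unfolding wnorm_eq by (intro N_mono) (auto simp: indicator_def simp flip: ennreal_plus)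
      also have "\<dots> \<le> ennreal K * (wnorm p w (\<lambda>x. f x - g x) + wnorm p w (\<lambda>x. g x * indicator (- ball x0 R) x))"
        unfolding wnorm_eq by (rule N_add_le) measurable
      also have "\<dots> \<le> ennreal K * (ennreal d + ennreal d)"
        using g elim by (intro mult_left_mono add_mono) auto
      also have "\<dots> = ennreal e"
        using d K_pos by (simp add: d_def field_simps flip: ennreal_plus ennreal_mult)
      finally show "wnorm p w (\<lambda>x. f x * indicator (- ball x0 R) x) \<le> ennreal e" .
    qed
  qed
qed

text \<open>Each f is close to some g of a finite net, and g to a continuous \<open>h g\<close>. The
  oscillation of f - \<open>h g\<close> is small by \<open>N_osc_le\<close>, uniformly in small r,
  and that of the finitely many \<open>h g\<close> is small for r below a common bound.\<close>

lemma totally_bounded_imp_osc: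
  "((\<lambda>r. SUP f\<in>F. N (osc q r f)) \<longlongrightarrow> 0) (at_right 0)"
  unfolding ennreal_tendsto_0_iff
proof (intro allI impI)
  fix e :: real assume e: "0 < e"
  obtain r0 D where r0: "0 < r0" and D: "0 < D"
    and osc: "\<And>r f. 0 < r \<Longrightarrow> r < r0 \<Longrightarrow> f \<in> borel_measurable lebesgue \<Longrightarrow> N (osc q r f) \<le> ennreal D * wnorm p w f"
    using N_osc_le by blast
  define c where "c = 2 * 2 powr (1 / q)"
  have c: "0 < c" by (simp add: c_def)
  \<comment> \<open>The final estimate is d times this denominator: \<open>c\<close> stems from
    \<open>osc_add_le\<close>, both factors K from triangle inequalities, D from
    \<open>N_osc_le\<close>.\<close>
  define d where "d = e / (c * (K * (D * (K * 2) + 1)))"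
  have pos: "0 < c * (K * (D * (K * 2) + 1))"
    using c D K_pos by (intro mult_pos_pos add_pos_pos) auto
  have d: "0 < d" using e pos by (simp add: d_def)
  obtain G where G: "finite G" "G \<subseteq> Lpw p w" "\<And>f. f \<in> F \<Longrightarrow> \<exists>g\<in>G. wnorm p w (\<lambda>x. f x - g x) \<le> ennreal d"
    using finite_net[OF d] by blast
  have "\<exists>h. (\<exists>R. continuous_on UNIV h \<and> (\<forall>x. R < norm x \<longrightarrow> h x = 0)) \<and> wnorm p w (\<lambda>x. g x - h x) \<le> ennreal d"
    if "g \<in> G" for g
    using continuous_approximation[OF _ d, of g] that G(2) by (metis subsetD)
  then obtain h where h: "\<And>g. g \<in> G \<Longrightarrow> \<exists>R. continuous_on UNIV (h g) \<and> (\<forall>x. R < norm x \<longrightarrow> h g x = 0)"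
    and gh: "\<And>g. g \<in> G \<Longrightarrow> wnorm p w (\<lambda>x. g x - h g x) \<le> ennreal d"
    by metis
  have "eventually (\<lambda>r. \<forall>g\<in>G. N (osc q r (h g)) \<le> ennreal d) (at_right 0)"
  proof (intro eventually_ball_finite G ballI)
    fix g assume "g \<in> G"
    from h[OF this] obtain R where "continuous_on UNIV (h g)" "\<And>x. R < norm x \<Longrightarrow> h g x = 0" by blast
    then show "eventually (\<lambda>r. N (osc q r (h g)) \<le> ennreal d) (at_right 0)"
      using d by (rule N_osc_continuous)
  qed
  then show "eventually (\<lambda>r. (SUP f\<in>F. N (osc q r f)) \<le> ennreal e) (at_right 0)"
    using eventually_at_right_real[OF r0]
  proof eventually_elim
    case (elim r)
    then have r: "0 < r" "r < r0" by auto
    show ?case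
    proof (rule SUP_least)
      fix f assume "f \<in> F"
      then obtain g where g: "g \<in> G" "wnorm p w (\<lambda>x. f x - g x) \<le> ennreal d" using G by blast
      have [measurable]: "f \<in> borel_measurable lebesgue" "g \<in> borel_measurable lebesgue"
        using \<open>f \<in> F\<close> F g(1) G(2) by (auto simp: Lpw_def)
      have [measurable]: "h g \<in> borel_measurable lebesgue"
        using h[OF g(1)] borel_measurable_continuous_onI[of "h g"] by (intro measurable_completion) auto
      have "wnorm p w (\<lambda>x. f x - h g x) \<le> ennreal K * (wnorm p w (\<lambda>x. f x - g x) + wnorm p w (\<lambda>x. g x - h g x))"
        by (rule wnorm_triangle) measurable
      also have "\<dots> \<le> ennreal K * (ennreal d + ennreal d)"
        using g gh by (intro mult_left_mono add_mono) auto
      also have "\<dots> = ennreal (K * (2 * d))"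
        using d K_pos by (simp flip: ennreal_plus ennreal_mult)
      finally have fh: "wnorm p w (\<lambda>x. f x - h g x) \<le> ennreal (K * (2 * d))" .
      have "N (osc q r f) = N (osc q r (\<lambda>x. (f x - h g x) + h g x))" by simp
      also have "\<dots> \<le> N (\<lambda>x. ennreal c * (osc q r (\<lambda>x. f x - h g x) x + osc q r (h g) x))"
        unfolding c_def using q_pos by (intro N_mono osc_add_le) auto
      also have "\<dots> \<le> ennreal c * N (\<lambda>x. osc q r (\<lambda>x. f x - h g x) x + osc q r (h g) x)"
        by (rule N_cmult_le[OF c])
      also have "\<dots> \<le> ennreal c * (ennreal K * (N (osc q r (\<lambda>x. f x - h g x)) + N (osc q r (h g))))"
        using r by (intro mult_left_mono N_add_le osc_measurable) auto
      also have "\<dots> \<le> ennreal c * (ennreal K * (ennreal D * ennreal (K * (2 * d)) + ennreal d))"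
        using elim g by (intro mult_left_mono add_mono order_trans[OF osc[OF r] mult_left_mono[OF fh]]) auto
      also have "\<dots> = ennreal (c * (K * (D * (K * (2 * d)) + d)))"
        using c K_pos D d by (simp flip: ennreal_plus ennreal_mult)
      also have "c * (K * (D * (K * (2 * d)) + d)) = d * (c * (K * (D * (K * 2) + 1)))"
        by (simp add: algebra_simps)
      also have "\<dots> = e" using pos d_def by (metis nonzero_eq_divide_eq less_irrefl)
      finally show "N (osc q r f) \<le> ennreal e" .
    qed
  qed
qed

end

end

section \<open>Sufficiency of the three conditions\<close>

text \<open>Taking for \<open>c\<close> the value of \<open>f\<close> at a point of the ball where the mean oscillation is almost
  minimal makes the estimate hold at every point of the ball, so that no averaging operator
  has to be applied to the oscillation.\<close>

lemma ball_constant_approximation: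
  fixes f :: "'a::euclidean_space \<Rightarrow> real"
  assumes q: "0 < q" and r: "0 < r" and \<eta>: "0 < \<eta>" and [measurable]: "f \<in> borel_measurable lebesgue"
  obtains c where "\<And>x. x \<in> ball z (r / 2) \<Longrightarrow>
    ennreal \<bar>f x - c\<bar> \<le> ennreal (4 * 2 powr (1 / q) * 2 powr (DIM('a) / q)) * (osc q r f x + ennreal \<eta>)"
proof -
  let ?n = "real DIM('a)"
  \<comment> \<open>The mean is taken over the fixed ball about z, not about x, so that its values
    at different x can be compared. For x in that ball the oscillation dominates it up to the root
    of 2^n, the volume ratio of balls of radii r and r/2.\<close>
  define U where "U x = enn_pow (ball_average (r / 2) (\<lambda>y. ennreal (\<bar>f x - f y\<bar> powr q)) z) (1 / q)" for x
  have U_le: "U x \<le> ennreal (2 powr (?n / q)) * osc q r f x" if x: "x \<in> ball z (r / 2)" for x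
  proof -
    have sub: "ball z (r / 2) \<subseteq> ball x r"
    proof
      fix y assume "y \<in> ball z (r / 2)"
      then show "y \<in> ball x r" using x dist_triangle[of x y z] by (simp add: dist_commute)
    qed
    let ?J = "\<integral>\<^sup>+ y\<in>ball x r. ennreal (\<bar>f x - f y\<bar> powr q) \<partial>lebesgue"
    let ?\<omega> = "measure lborel (ball (0::'a) 1)"
    have \<omega>: "0 < ?\<omega>" by (rule content_unit_ball_pos)
    have "ball_average (r / 2) (\<lambda>y. ennreal (\<bar>f x - f y\<bar> powr q)) z \<le> ?J / ennreal (?\<omega> * (r / 2) ^ DIM('a))"
      unfolding ball_average_def using r sub
      by (subst emeasure_ball_lebesgue)
         (auto intro!: divide_right_mono_ennreal nn_integral_mono mult_left_mono simp: indicator_def)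
    also have "\<dots> = ennreal (2 ^ DIM('a)) * (?J / ennreal (?\<omega> * r ^ DIM('a)))"
      using r \<omega> by (simp add: divide_ennreal_real power_divide flip: mult.assoc ennreal_mult)
    also have "\<dots> = ennreal (2 powr ?n) * ball_average r (\<lambda>y. ennreal (\<bar>f x - f y\<bar> powr q)) x"
      unfolding ball_average_def using r by (subst emeasure_ball_lebesgue) (auto simp: powr_realpow)
    finally have "U x \<le> enn_pow (ennreal (2 powr ?n) * ball_average r (\<lambda>y. ennreal (\<bar>f x - f y\<bar> powr q)) x) (1 / q)"
      unfolding U_def using q by (intro enn_pow_mono) auto
    then show ?thesis
      by (simp add: enn_pow_cmult powr_powr osc_eq_ball_average)
  qed
  \<comment> \<open>The infimum need not be attained, whence the slack \<eta>; if it is infinite,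
    every point of the ball qualifies.\<close>
  obtain y0 where y0: "y0 \<in> ball z (r / 2)" "U y0 \<le> (INF x\<in>ball z (r / 2). U x) + ennreal \<eta>"
  proof (cases "(INF x\<in>ball z (r / 2). U x) < top")
    case True
    then have "(INF x\<in>ball z (r / 2). U x) < (INF x\<in>ball z (r / 2). U x) + ennreal \<eta>"
      using \<eta> by (cases "INF x\<in>ball z (r / 2). U x") (auto simp: ennreal_less_iff simp flip: ennreal_plus)
    then obtain y where "y \<in> ball z (r / 2)" "U y < (INF x\<in>ball z (r / 2). U x) + ennreal \<eta>"
      unfolding INF_less_iff by blast
    then show thesis using that[of y] by simp
  next
    case False
    then have "(INF x\<in>ball z (r / 2). U x) = top" by (simp add: less_top[symmetric])
    then show thesis using that[of z] r by simp
  qed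
  show thesis
  proof (rule that[of "f y0"])
    fix x assume x: "x \<in> ball z (r / 2)"
    \<comment> \<open>The constant |f(x) - f(y0)|^q is averaged over y, so that the difference can
      be split through f(y).\<close>
    have "ennreal \<bar>f x - f y0\<bar> = enn_pow (ball_average (r / 2) (\<lambda>y. ennreal (\<bar>f x - f y0\<bar> powr q)) z) (1 / q)"
      using r q by (simp add: ball_average_const enn_pow_ennreal powr_powr)
    also have "\<dots> \<le> ennreal (2 * 2 powr (1 / q)) * (U x + U y0)"
      unfolding U_def using q by (intro enn_pow_ball_average_le abs_powr_add_le) auto
    also have "\<dots> \<le> ennreal (2 * 2 powr (1 / q)) * (ennreal (2 * 2 powr (?n / q)) * (osc q r f x + ennreal \<eta>))"
    proof (rule mult_left_mono)
      have "U y0 \<le> U x + ennreal \<eta>"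
        using y0(2) INF_lower[OF x, of U] by (meson add_right_mono order_trans)
      then have "U x + U y0 \<le> U x + (U x + ennreal \<eta>)" by (rule add_left_mono)
      also have "\<dots> = ennreal 2 * U x + ennreal \<eta>" by (simp add: mult_2 add.assoc)
      also have "\<dots> \<le> ennreal 2 * (ennreal (2 powr (?n / q)) * osc q r f x) + ennreal (2 * 2 powr (?n / q)) * ennreal \<eta>"
      proof (intro add_mono mult_left_mono U_le x)
        have "1 * \<eta> \<le> (2 * 2 powr (?n / q)) * \<eta>"
          using \<eta> q ge_one_powr_ge_zero[of 2 "?n / q"] by (intro mult_right_mono) auto
        then show "ennreal \<eta> \<le> ennreal (2 * 2 powr (?n / q)) * ennreal \<eta>"
          using \<eta> by (subst ennreal_mult[symmetric]) (auto intro!: ennreal_leI)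
      qed simp
      also have "ennreal 2 * (ennreal (2 powr (?n / q)) * osc q r f x) = ennreal (2 * 2 powr (?n / q)) * osc q r f x"
        by (subst mult.assoc[symmetric], subst ennreal_mult''[symmetric]) auto
      finally show "U x + U y0 \<le> ennreal (2 * 2 powr (?n / q)) * (osc q r f x + ennreal \<eta>)"
        by (simp add: distrib_left)
    qed simp
    also have "\<dots> = ennreal (4 * 2 powr (1 / q) * 2 powr (?n / q)) * (osc q r f x + ennreal \<eta>)"
      by (subst mult.assoc[symmetric], subst ennreal_mult''[symmetric]) (auto simp: mult_ac)
    finally show "ennreal \<bar>f x - f y0\<bar> \<le> ennreal (4 * 2 powr (1 / q) * 2 powr (?n / q)) * (osc q r f x + ennreal \<eta>)" .
  qed
qed

text \<open>Supplies the finitely many rounded values that a coefficient of the step functions may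
  take.\<close>

lemma finite_bounded_multiples:
  fixes \<eta> B :: real
  assumes "0 < \<eta>"
  shows "finite {t. \<bar>t\<bar> \<le> B \<and> (\<exists>k::int. t = \<eta> * of_int k)}"
proof (rule finite_subset)
  show "{t. \<bar>t\<bar> \<le> B \<and> (\<exists>k::int. t = \<eta> * of_int k)} \<subseteq> (\<lambda>k. \<eta> * of_int k) ` {\<lceil>- (B / \<eta>)\<rceil>..\<lfloor>B / \<eta>\<rfloor>}"
  proof (safe intro!: imageI)
    fix k :: int assume "\<bar>\<eta> * of_int k\<bar> \<le> B"
    then have "of_int k \<le> B / \<eta>" "- (B / \<eta>) \<le> of_int k"
      using assms by (auto simp: field_simps abs_le_iff)
    then show "k \<in> {\<lceil>- (B / \<eta>)\<rceil>..\<lfloor>B / \<eta>\<rfloor>}"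
      unfolding atLeastAtMost_iff ceiling_le_iff le_floor_iff by simp
  qed
qed simp

context weighted_space
begin

text \<open>The net must be fixed before f is. The cells depend only on B, r and a finite cover, and
  the coefficient c on a cell E satisfies |c| N(1_E) <= b1 with b1 common to all f; rounding to
  multiples of \<eta> then leaves finitely many step functions.\<close>

lemma totally_bounded_if:
  assumes F: "F \<subseteq> Lpw p w" and bdd: "(SUP f\<in>F. wnorm p w f) < \<infinity>"
    and osc: "((\<lambda>r. SUP f\<in>F. N (osc q r f)) \<longlongrightarrow> 0) (at_right 0)"
    and tail: "((\<lambda>R. SUP f\<in>F. wnorm p w (\<lambda>x. f x * indicator (- ball x0 R) x)) \<longlongrightarrow> 0) at_top"
  shows "totally_bounded_Lpw p w F"
  unfolding totally_bounded_Lpw_def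
proof (intro allI impI)
  fix e :: real assume e: "0 < e"
  define C where "C = 4 * 2 powr (1 / q) * 2 powr (DIM('a) / q)"
  have "1 * 1 * 1 \<le> C"
    unfolding C_def using q_pos by (intro mult_mono ge_one_powr_ge_zero mult_nonneg_nonneg) auto
  then have C: "1 \<le> C" by simp
  \<comment> \<open>The final bound is d K (3 C K + 1) = e/2, strictly below e as total boundedness
    demands.\<close>
  define d where "d = e / (2 * (K * (C * (K * 3) + 1)))"
  have pos: "0 < K * (C * (K * 3) + 1)"
    using C K_pos by (intro mult_pos_pos add_pos_pos) auto
  have d: "0 < d" using e pos by (simp add: d_def)
  obtain R where tailR: "\<And>f. f \<in> F \<Longrightarrow> wnorm p w (\<lambda>x. f x * indicator (- ball x0 R) x) \<le> ennreal d"
  proof -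
    have "eventually (\<lambda>R. (SUP f\<in>F. wnorm p w (\<lambda>x. f x * indicator (- ball x0 R) x)) \<le> ennreal d) at_top"
      using tail d unfolding ennreal_tendsto_0_iff by blast
    then obtain R where "(SUP f\<in>F. wnorm p w (\<lambda>x. f x * indicator (- ball x0 R) x)) \<le> ennreal d"
      unfolding eventually_at_top_linorder by blast
    then show thesis using that[of R] by (simp add: SUP_le_iff)
  qed
  obtain r where r: "0 < r" and oscr: "\<And>f. f \<in> F \<Longrightarrow> N (osc q r f) \<le> ennreal d"
  proof -
    have "eventually (\<lambda>r. (SUP f\<in>F. N (osc q r f)) \<le> ennreal d) (at_right 0)"
      using osc d unfolding ennreal_tendsto_0_iff by blast
    then have "eventually (\<lambda>r. (SUP f\<in>F. N (osc q r f)) \<le> ennreal d \<and> 0 < r) (at_right 0)"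
      using eventually_at_right_less by (rule eventually_conj)
    then obtain r :: real where "(SUP f\<in>F. N (osc q r f)) \<le> ennreal d" "0 < r"
      using eventually_happens'[OF trivial_limit_at_right_real] by blast
    then show thesis using that[of r] by (simp add: SUP_le_iff)
  qed
  define B where "B = ball x0 R"
  have [measurable]: "B \<in> sets lebesgue" by (simp add: B_def)
  obtain \<beta> where \<beta>: "0 \<le> \<beta>" "N (indicator B) = ennreal \<beta>"
    using N_indicator_finite[of B] by (cases "N (indicator B)") (auto simp: B_def)
  \<comment> \<open>Makes the norm of \<eta> times the indicator of B at most d, also when \<beta> =
    0.\<close>
  define \<eta> where "\<eta> = d / (\<beta> + 1)"
  have \<eta>: "0 < \<eta>" using d \<beta> by (simp add: \<eta>_def)
  have \<eta>\<beta>: "ennreal \<eta> * N (indicator B) \<le> ennreal d"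
    unfolding \<beta>(2) using d \<beta>(1) by (simp add: \<eta>_def field_simps flip: ennreal_mult)
  obtain M where M: "0 \<le> M" "(SUP f\<in>F. wnorm p w f) = ennreal M"
    using bdd by (cases "SUP f\<in>F. wnorm p w f") auto
  obtain Z where Z: "finite Z" "cball x0 R \<subseteq> (\<Union>z\<in>Z. ball z (r / 2))"
    using compact_eq_totally_bounded[of "cball x0 R"] r by (metis compact_cball half_gt_zero)
  obtain m :: nat and z where z: "Z = z ` {i. i < m}"
    using Z(1) by (auto simp: finite_conv_nat_seg_image)
  \<comment> \<open>Subtracting the balls of smaller index makes the cells disjoint; a point of B
    lies in the cell of the least index whose ball contains it.\<close>
  define E where "E j = B \<inter> (ball (z j) (r / 2) - (\<Union>i<j. ball (z i) (r / 2)))" for j :: nat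
  have [measurable]: "E j \<in> sets lebesgue" for j
    unfolding E_def by (intro sets.Int sets.Diff sets.countable_UN') auto
  have E_cover: "\<exists>j<m. x \<in> E j" if "x \<in> B" for x
  proof -
    have "x \<in> cball x0 R" using that by (simp add: B_def)
    then have ex: "\<exists>j. j < m \<and> x \<in> ball (z j) (r / 2)" using Z(2) unfolding z by blast
    define j where "j = (LEAST j. j < m \<and> x \<in> ball (z j) (r / 2))"
    have "j < m \<and> x \<in> ball (z j) (r / 2)" unfolding j_def using ex by (rule LeastI_ex)
    moreover have "x \<notin> ball (z i) (r / 2)" if "i < j" for i
      using not_less_Least[of i "\<lambda>j. j < m \<and> x \<in> ball (z j) (r / 2)"] that calculation
      unfolding j_def[symmetric] by auto
    ultimately show ?thesis using that by (auto simp: E_def)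
  qed
  have E_disj: "i = j" if "x \<in> E i" "x \<in> E j" for x i j
    using that by (cases i j rule: linorder_cases) (auto simp: E_def)
  define step where "step t x = (\<Sum>i<m. t i * indicator (E i) x)" for t :: "nat \<Rightarrow> real" and x
  have step_in: "step t x = t j" if "j < m" "x \<in> E j" for t x j
  proof -
    have "step t x = (\<Sum>i<m. if i = j then t i else 0)"
      unfolding step_def using that E_disj by (intro sum.cong) (auto simp: indicator_def)
    then show ?thesis using that by simp
  qed
  have step_out: "step t x = 0" if "x \<notin> B" for t x
    unfolding step_def using that by (intro sum.neutral) (auto simp: E_def)
  have step_meas [measurable]: "step t \<in> borel_measurable lebesgue" for t
    unfolding step_def[abs_def] by measurable
  \<comment> \<open>Bounds |c| times the norm of a cell's indicator: f contributes M, and f - c at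
    most C times the norm estimated in \<open>NB\<close> with k = 1.\<close>
  define b1 where "b1 = K * (M + C * (K * (2 * d)))"
  \<comment> \<open>The summand \<eta> allows for rounding. On a cell of norm 0 the quotient is 0,
    which still admits the coefficient 0 used there.\<close>
  define \<Lambda> where "\<Lambda> j = b1 / enn2real (N (indicator (E j))) + \<eta>" for j
  define G where "G = step ` (Pi\<^sub>E {..<m} (\<lambda>j. {t. \<bar>t\<bar> \<le> \<Lambda> j \<and> (\<exists>k::int. t = \<eta> * of_int k)}))"
  have b1: "0 \<le> b1" unfolding b1_def using K_pos M C d by simp
  have \<Lambda>: "0 \<le> \<Lambda> j" for j unfolding \<Lambda>_def using b1 \<eta> by simp
  have NE: "N (indicator (E j)) < top" for j
    using N_indicator_finite[of "E j"] by (simp add: E_def B_def bounded_Int)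
  show "\<exists>G. finite G \<and> G \<subseteq> Lpw p w \<and> (\<forall>f\<in>F. \<exists>g\<in>G. wnorm p w (\<lambda>x. f x - g x) < ennreal e)"
  proof (intro exI[of _ G] conjI ballI)
    show "finite G"
      unfolding G_def by (intro finite_imageI finite_PiE finite_bounded_multiples \<eta>) simp
    show "G \<subseteq> Lpw p w"
    proof -
      have "step t \<in> Lpw p w" for t
      proof -
        let ?s = "1 + (\<Sum>j<m. \<bar>t j\<bar>)"
        have s: "0 < ?s" by (simp add: add_pos_nonneg sum_nonneg)
        have "ennreal \<bar>step t x\<bar> \<le> ennreal ?s * indicator B x" for x
        proof (cases "x \<in> B")
          case True
          then obtain j where j: "j < m" "x \<in> E j" using E_cover by blast
          have "\<bar>t j\<bar> \<le> (\<Sum>j<m. \<bar>t j\<bar>)" using j by (intro member_le_sum) auto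
          then show ?thesis using True by (simp add: step_in[OF j] ennreal_leI del: ennreal_plus)
        qed (simp add: step_out)
        then have "wnorm p w (step t) \<le> N (\<lambda>x. ennreal ?s * indicator B x)"
          unfolding wnorm_eq by (rule N_mono)
        also have "\<dots> \<le> ennreal ?s * N (indicator B)" by (rule N_cmult_le[OF s])
        also have "\<dots> < \<infinity>" unfolding \<beta>(2) by (simp add: ennreal_mult_less_top)
        finally show ?thesis by (simp add: Lpw_def)
      qed
      then show ?thesis by (auto simp: G_def)
    qed
    fix f assume f: "f \<in> F"
    have [measurable]: "f \<in> borel_measurable lebesgue" using f F by (auto simp: Lpw_def)
    have osc_meas [measurable]: "osc q r f \<in> borel_measurable lebesgue" using r by (intro osc_measurable) auto
    have fM: "wnorm p w f \<le> ennreal M"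
      unfolding M(2)[symmetric] using f by (rule SUP_upper)
    have "\<forall>j. \<exists>c. \<forall>x\<in>ball (z j) (r / 2). ennreal \<bar>f x - c\<bar> \<le> ennreal C * (osc q r f x + ennreal \<eta>)"
      unfolding C_def using ball_constant_approximation[OF q_pos r \<eta>, of f] by (metis \<open>f \<in> borel_measurable lebesgue\<close>)
    then obtain c where c: "\<And>j x. x \<in> ball (z j) (r / 2) \<Longrightarrow> ennreal \<bar>f x - c j\<bar> \<le> ennreal C * (osc q r f x + ennreal \<eta>)"
      by metis
    have cE: "ennreal \<bar>f x - c j\<bar> \<le> ennreal C * (osc q r f x + ennreal \<eta> * indicator B x)" if "x \<in> E j" for x j
      using c[of x j] that by (auto simp: E_def)
    \<comment> \<open>k counts multiples of \<eta>: one comes from the approximation of f by c, a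
      second from rounding c.\<close>
    have NB: "N (\<lambda>x. osc q r f x + ennreal k * (ennreal \<eta> * indicator B x)) \<le> ennreal (K * ((1 + k) * d))"
      if k: "0 < k" for k
    proof -
      have "N (\<lambda>x. osc q r f x + ennreal k * (ennreal \<eta> * indicator B x))
          \<le> ennreal K * (N (osc q r f) + N (\<lambda>x. ennreal k * (ennreal \<eta> * indicator B x)))"
        by (rule N_add_le) measurable
      also have "\<dots> \<le> ennreal K * (ennreal d + ennreal k * (ennreal \<eta> * N (indicator B)))"
        using k \<eta> by (intro mult_left_mono add_mono oscr f order_trans[OF N_cmult_le mult_left_mono[OF N_cmult_le]]) auto
      also have "\<dots> \<le> ennreal K * (ennreal d + ennreal k * ennreal d)"
        by (intro mult_left_mono add_mono \<eta>\<beta>) auto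
      also have "\<dots> = ennreal (K * (d + k * d))"
        using k d K_pos by (simp flip: ennreal_plus ennreal_mult)
      finally show ?thesis by (simp add: distrib_right)
    qed
    \<comment> \<open>On \<open>E j\<close> the number |c j| is at most |f| plus the approximation
      error; taking norms bounds it by a quantity into which f enters only through M.\<close>
    have c_bound: "\<bar>c j\<bar> \<le> b1 / enn2real (N (indicator (E j)))" if pos: "N (indicator (E j)) \<noteq> 0" for j
    proof (cases "c j = 0")
      case True
      then show ?thesis using b1 by simp
    next
      case False
      let ?h = "\<lambda>x. ennreal C * (osc q r f x + ennreal 1 * (ennreal \<eta> * indicator B x))"
      have "ennreal \<bar>c j\<bar> * indicator (E j) x \<le> ennreal \<bar>f x\<bar> + ?h x" for x
      proof (cases "x \<in> E j")
        case True
        have "ennreal \<bar>c j\<bar> \<le> ennreal \<bar>f x\<bar> + ennreal \<bar>f x - c j\<bar>" by (auto simp flip: ennreal_plus)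
        also have "\<dots> \<le> ennreal \<bar>f x\<bar> + ?h x" using cE[OF True] by (intro add_left_mono) simp
        finally show ?thesis using True by simp
      qed simp
      then have 1: "N (\<lambda>x. ennreal \<bar>c j\<bar> * indicator (E j) x) \<le> N (\<lambda>x. ennreal \<bar>f x\<bar> + ?h x)"
        by (rule N_mono)
      have "N (indicator (E j)) = N (\<lambda>x. ennreal (1 / \<bar>c j\<bar>) * (ennreal \<bar>c j\<bar> * indicator (E j) x))"
        using False by (simp flip: mult.assoc ennreal_mult)
      also have "\<dots> \<le> ennreal (1 / \<bar>c j\<bar>) * N (\<lambda>x. ennreal \<bar>c j\<bar> * indicator (E j) x)"
        using False by (intro N_cmult_le) auto
      also have "\<dots> \<le> ennreal (1 / \<bar>c j\<bar>) * N (\<lambda>x. ennreal \<bar>f x\<bar> + ?h x)"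
        by (intro mult_left_mono 1) auto
      also have "\<dots> \<le> ennreal (1 / \<bar>c j\<bar>) * (ennreal K * (N (\<lambda>x. ennreal \<bar>f x\<bar>) + N ?h))"
        by (intro mult_left_mono N_add_le) auto
      also have "\<dots> \<le> ennreal (1 / \<bar>c j\<bar>) * (ennreal K * (ennreal M + ennreal C * ennreal (K * ((1 + 1) * d))))"
        using fM C NB[of 1] unfolding wnorm_eq
        by (intro mult_left_mono add_mono order_trans[OF N_cmult_le mult_left_mono[OF NB]]) auto
      also have "\<dots> = ennreal (b1 / \<bar>c j\<bar>)"
        unfolding b1_def using M(1) C K_pos d by (simp flip: ennreal_plus ennreal_mult)
      finally have "ennreal (enn2real (N (indicator (E j)))) \<le> ennreal (b1 / \<bar>c j\<bar>)"
        using NE[of j] by (simp add: less_top)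
      then have "enn2real (N (indicator (E j))) \<le> b1 / \<bar>c j\<bar>"
        using b1 by (simp add: ennreal_le_iff)
      moreover have "0 < enn2real (N (indicator (E j)))"
        using pos NE[of j] by (simp add: enn2real_positive_iff zero_less_iff_neq_zero)
      ultimately show ?thesis using False by (simp add: field_simps)
    qed
    \<comment> \<open>On a cell whose indicator has norm 0 there is no bound on \<open>c j\<close>;
      the coefficient 0 does no harm, since such a cell is null.\<close>
    define t where "t = restrict (\<lambda>j. if N (indicator (E j)) = 0 then 0 else \<eta> * of_int \<lfloor>c j / \<eta>\<rfloor>) {..<m}"
    have t_close: "\<bar>c j - \<eta> * of_int \<lfloor>c j / \<eta>\<rfloor>\<bar> \<le> \<eta>" for j
    proof -
      have "of_int \<lfloor>c j / \<eta>\<rfloor> * \<eta> \<le> c j" "c j \<le> (of_int \<lfloor>c j / \<eta>\<rfloor> + 1) * \<eta>"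
        using \<eta> by (subst pos_le_divide_eq[symmetric] pos_divide_le_eq[symmetric]; linarith)+
      then show ?thesis using \<eta> by (simp add: algebra_simps abs_le_iff)
    qed
    have "t \<in> Pi\<^sub>E {..<m} (\<lambda>j. {t. \<bar>t\<bar> \<le> \<Lambda> j \<and> (\<exists>k::int. t = \<eta> * of_int k)})"
    proof (rule PiE_I)
      fix j assume j: "j \<in> {..<m}"
      show "t j \<in> {t. \<bar>t\<bar> \<le> \<Lambda> j \<and> (\<exists>k::int. t = \<eta> * of_int k)}"
      proof (cases "N (indicator (E j)) = 0")
        case True
        then show ?thesis using j \<Lambda>[of j] by (auto simp: t_def intro!: exI[of _ 0])
      next
        case False
        have "\<bar>\<eta> * of_int \<lfloor>c j / \<eta>\<rfloor>\<bar> \<le> \<bar>c j\<bar> + \<eta>" using t_close[of j] by linarith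
        then have "\<bar>\<eta> * of_int \<lfloor>c j / \<eta>\<rfloor>\<bar> \<le> \<Lambda> j" using c_bound[OF False] by (simp add: \<Lambda>_def)
        then show ?thesis using j False by (auto simp: t_def)
      qed
    qed (simp add: t_def)
    then have tG: "step t \<in> G" by (simp add: G_def)
    have "AE x in lebesgue. \<forall>j\<in>{..<m}. x \<in> E j \<longrightarrow> N (indicator (E j)) \<noteq> 0"
    proof (rule AE_finite_allI)
      fix j
      show "AE x in lebesgue. x \<in> E j \<longrightarrow> N (indicator (E j)) \<noteq> 0"
      proof (cases "N (indicator (E j)) = 0")
        case True
        then have "AE x in lebesgue. indicator (E j) x = (0::ennreal)" by (intro N_eq_0_AE) auto
        then show ?thesis by eventually_elim (auto simp: indicator_def split: if_splits)
      qed simp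
    qed simp
    then have "AE x in lebesgue. ennreal \<bar>f x - step t x\<bar>
        \<le> ennreal C * (osc q r f x + ennreal 2 * (ennreal \<eta> * indicator B x)) + ennreal \<bar>f x * indicator (- B) x\<bar>"
    proof eventually_elim
      case (elim x)
      show ?case
      proof (cases "x \<in> B")
        case True
        then obtain j where j: "j < m" "x \<in> E j" using E_cover by blast
        then have nz: "N (indicator (E j)) \<noteq> 0" using elim by auto
        have "ennreal \<bar>f x - step t x\<bar> \<le> ennreal \<bar>f x - c j\<bar> + ennreal \<bar>c j - t j\<bar>"
          unfolding step_in[OF j] by (auto simp flip: ennreal_plus)
        also have "ennreal \<bar>c j - t j\<bar> \<le> ennreal (C * \<eta>)"
        proof (rule ennreal_leI)
          have "\<bar>c j - t j\<bar> \<le> 1 * \<eta>" using t_close[of j] j(1) nz by (simp add: t_def)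
          also have "\<dots> \<le> C * \<eta>" using C \<eta> by (intro mult_right_mono) auto
          finally show "\<bar>c j - t j\<bar> \<le> C * \<eta>" .
        qed
        also have "ennreal \<bar>f x - c j\<bar> \<le> ennreal C * (osc q r f x + ennreal \<eta>)"
          using cE[OF j(2)] True by simp
        finally have "ennreal \<bar>f x - step t x\<bar> \<le> ennreal C * (osc q r f x + ennreal \<eta>) + ennreal (C * \<eta>)"
          by (simp add: add_mono)
        also have "ennreal (C * \<eta>) = ennreal C * ennreal \<eta>" using C \<eta> by (simp add: ennreal_mult)
        finally show ?thesis using True by (simp add: distrib_left mult_2 add.assoc)
      next
        case False
        then show ?thesis by (simp add: step_out)
      qed
    qed
    then have "wnorm p w (\<lambda>x. f x - step t x)
        \<le> N (\<lambda>x. ennreal C * (osc q r f x + ennreal 2 * (ennreal \<eta> * indicator B x)) + ennreal \<bar>f x * indicator (- B) x\<bar>)"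
      unfolding wnorm_eq by (rule N_mono_AE)
    also have "\<dots> \<le> ennreal K * (N (\<lambda>x. ennreal C * (osc q r f x + ennreal 2 * (ennreal \<eta> * indicator B x)))
        + N (\<lambda>x. ennreal \<bar>f x * indicator (- B) x\<bar>))"
      by (rule N_add_le) measurable
    also have "\<dots> \<le> ennreal K * (ennreal C * ennreal (K * ((1 + 2) * d)) + ennreal d)"
      using C tailR[OF f] unfolding wnorm_eq B_def[symmetric]
      by (intro mult_left_mono add_mono order_trans[OF N_cmult_le mult_left_mono[OF NB]]) auto
    also have "\<dots> = ennreal (K * (C * (K * ((1 + 2) * d)) + d))"
      using C K_pos d by (simp flip: ennreal_plus ennreal_mult)
    also have "K * (C * (K * ((1 + 2) * d)) + d) = d * (K * (C * (K * 3) + 1))"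
      by (simp add: algebra_simps)
    also have "\<dots> = e / 2"
      using pos d_def by (metis nonzero_eq_divide_eq less_irrefl divide_divide_eq_left)
    also have "ennreal (e / 2) < ennreal e" using e by (simp add: ennreal_less_iff)
    finally show "\<exists>g\<in>G. wnorm p w (\<lambda>x. f x - g x) < ennreal e" using tG by blast
  qed
qed

end

theorem theorem1p1:
  fixes p :: "'a::euclidean_space \<Rightarrow> real" and w :: "'a \<Rightarrow> real"
    and q :: real and x0 :: 'a and F :: "('a \<Rightarrow> real) set"
  assumes "in_P0 p" and "in_LH p"
    and "0 < q" and "q < ess_inf_exp p"
    and "is_weight w"
    and "A_var (\<lambda>x. p x / q) (\<lambda>x. w x powr q)"
    and "F \<subseteq> Lpw p w"
  shows "totally_bounded_Lpw p w F \<longleftrightarrow>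
    ((SUP f\<in>F. wnorm p w f) < \<infinity> \<and>
     ((\<lambda>r. SUP f\<in>F. wnorm_enn p w (osc q r f)) \<longlongrightarrow> 0) (at_right 0) \<and>
     ((\<lambda>R. SUP f\<in>F. wnorm p w (\<lambda>x. f x * indicator (- ball x0 R) x)) \<longlongrightarrow> 0) at_top)"
proof -
  \<comment> \<open>On the reals \<open>Sup\<close> of the empty set carries no information; for a
    nonempty set, q < \<open>ess_inf_exp p\<close> yields one almost everywhere lower bound a >
    q.\<close>
  have "{a. AE x in lebesgue. a \<le> p x} \<noteq> {}"
    using assms(1) by (auto simp: in_P0_def)
  then obtain a where a: "q < a" "AE x in lebesgue. a \<le> p x"
    using less_cSupD[of "{a. AE x in lebesgue. a \<le> p x}" q] assms(4) by (auto simp: ess_inf_exp_def)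
  obtain b where b: "AE x in lebesgue. p x \<le> b"
    using assms(1) by (auto simp: in_P0_def)
  \<comment> \<open>Taking \<open>max a b\<close> secures that the upper bound is at least a without
    comparing the two almost everywhere bounds.\<close>
  interpret weighted_space p a "max a b" w q
  proof
    show "p \<in> borel_measurable lebesgue" using assms(1) by (simp add: in_P0_def)
    show "AE x in lebesgue. a \<le> p x \<and> p x \<le> max a b"
      using a(2) b by eventually_elim auto
  qed (use assms a in auto)
  show ?thesis
    using totally_bounded_imp_bounded[OF assms(7)] totally_bounded_imp_osc[OF assms(7)]
      totally_bounded_imp_tails[OF assms(7)] totally_bounded_if[OF assms(7)] by blast
qed

end
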